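(* There is a universal constant $c>0$ such that for all integers $d\ge2$ and all $0<\epsilon<1/6$ the following holds. Consider a copywise (incoherent) adaptive protocol using $N$ copies of $\rho\otimes\rho^*$ in which every POVM used in every round satisfies the reduction-criterion restriction. If, for every $d$-dimensional state $\rho$, the protocol learns all displacement amplitudes of $\rho$ to additive error $\epsilon$ with success probability at least $2/3$, then $$N\ \ge\ c\,\epsilon^{-2}\sqrt d ,$$ i.e. $N=\Omega(\epsilon^{-2}\sqrt d)$.
   Context: Displacement operators on $\mathbb C^d$ with computational basis $\{|j\rangle\}_{j\in\mathbb Z_d}$: $X|j\rangle=|j+1 \bmod d\rangle$, $Z|j\rangle=e^{2\pi ij/d}|j\rangle$, $D_{q,p}:=e^{i\pi qp/d}X^qZ^p$ for $q,p\in\mathbb Z_d$ (identified with representatives in $\{0,\dots,d-1\}$). The displacement amplitudes of a density operator $\rho$ on $\mathbb C^d$ are $y_{q,p}=\mathrm{Tr}(D_{q,p}\rho)$. $\rho^*$ is the entrywise complex conjugate of $\rho$ in the computational basis. Learning task: given $N$ copies of $\rho\otimes\rho^*$ for an unknown $\rho$, output estimates $\hat y_{q,p}$ with $|\hat y_{q,p}-y_{q,p}|\le\epsilon$ simultaneously for all $q,p\in\mathbb Z_d$, with probability at least $2/3$. Copywise adaptive protocol: in round $m=1,\dots,N$ one copy of $\rho\otimes\rho^*$, held on registers $S_mA_m$ ($S_m\cong\mathbb C^d$ contains $\rho$, $A_m\cong\mathbb C^d$ contains $\rho^*$), is measured separately by a joint POVM $\{M_{o_m}^{\mathbf o_{<m}}\}_{o_m}$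 on $S_mA_m$ (finitely many outcomes), which may depend arbitrarily on the previous outcomes $\mathbf o_{<m}=(o_1,\dots,o_{m-1})$. No quantum memory is retained across copies. Estimates are computed from the full outcome record. Reduction-criterion restriction for a POVM $\{M_o\}$ on $SA$: for every outcome with $\mathrm{Tr}\,M_o>0$, $\dfrac{M_o}{\mathrm{Tr}\,M_o}\le I_S\otimes\sigma_A^o$ with $\sigma_A^o=\dfrac{\mathrm{Tr}_S M_o}{\mathrm{Tr}\,M_o}$, where $X\le Y$ means $Y-X$ is positive semidefinite. *)

theory Defs
  imports Complex_Main "Jordan_Normal_Form.Matrix"
begin

definition mtrace :: "complex mat \<Rightarrow> complex" where
  "mtrace A = (\<Sum>i<dim_row A. A $$ (i, i))"

text \<open>The order on complex numbers used here is that of HOL-Library.Complex_Order: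
  \<open>0 \<le> z\<close> means that \<open>z\<close> is real and nonnegative.
  In particular \<open>psd_mat n A\<close> entails that \<open>A\<close> is Hermitian.\<close>

definition psd_mat :: "nat \<Rightarrow> complex mat \<Rightarrow> bool" where
  "psd_mat n A \<longleftrightarrow> A \<in> carrier_mat n n \<and>
     (\<forall>v \<in> carrier_vec n. 0 \<le> (A *\<^sub>v v) \<bullet>c v)"

definition loewner_le :: "nat \<Rightarrow> complex mat \<Rightarrow> complex mat \<Rightarrow> bool" where
  "loewner_le n A B \<longleftrightarrow>
     A \<in> carrier_mat n n \<and> B \<in> carrier_mat n n \<and> psd_mat n (B - A)"

definition density_operator :: "nat \<Rightarrow> complex mat \<Rightarrow> bool" where
  "density_operator n \<rho> \<longleftrightarrow> psd_mat n \<rho> \<and> mtrace \<rho> = 1"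

definition conj_mat :: "complex mat \<Rightarrow> complex mat" where
  "conj_mat A = map_mat cnj A"

text \<open>Operators on a bipartite space \<open>S \<otimes> A\<close> with \<open>dim A = d\<close>: the basis vector
  \<open>|s\<rangle> \<otimes> |a\<rangle>\<close> has index \<open>s * d + a\<close>.\<close>

definition tensor_mat :: "complex mat \<Rightarrow> complex mat \<Rightarrow> complex mat"  (infixl "\<otimes>\<^sub>m" 70) where
  "A \<otimes>\<^sub>m B = mat (dim_row A * dim_row B) (dim_col A * dim_col B)
     (\<lambda>(i, j). A $$ (i div dim_row B, j div dim_col B)
             * B $$ (i mod dim_row B, j mod dim_col B))"

definition partial_trace_S :: "nat \<Rightarrow> complex mat \<Rightarrow> complex mat" where
  "partial_trace_S d M = mat d d (\<lambda>(a, b). \<Sum>s<d. M $$ (s * d + a, s * d + b))"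

definition shift_mat :: "nat \<Rightarrow> complex mat" where
  "shift_mat d = mat d d (\<lambda>(i, j). if i = (j + 1) mod d then 1 else 0)"

definition clock_mat :: "nat \<Rightarrow> complex mat" where
  "clock_mat d = mat d d
     (\<lambda>(i, j). if i = j then exp (2 * complex_of_real pi * \<i> * of_nat j / of_nat d) else 0)"

text \<open>The indices are the representatives \<open>0, \<dots>, d - 1\<close> of residues modulo \<open>d\<close>; the phase is
  only well defined for fixed representatives, as it is not \<open>d\<close>-periodic in \<open>q\<close> and \<open>p\<close>.\<close>

definition displacement :: "nat \<Rightarrow> nat \<Rightarrow> nat \<Rightarrow> complex mat" where
  "displacement d q p =
     exp (\<i> * complex_of_real pi * of_nat q * of_nat p / of_nat d)
       \<cdot>\<^sub>m ((shift_mat d ^\<^sub>m q) * (clock_mat d ^\<^sub>m p))"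

definition amplitude :: "nat \<Rightarrow> complex mat \<Rightarrow> nat \<Rightarrow> nat \<Rightarrow> complex" where
  "amplitude d \<rho> q p = mtrace (displacement d q p * \<rho>)"

text \<open>The completeness relation is stated entrywise because the type of matrices of arbitrary
  dimension has no zero and hence no big sums.\<close>

definition is_povm :: "nat \<Rightarrow> nat set \<Rightarrow> (nat \<Rightarrow> complex mat) \<Rightarrow> bool" where
  "is_povm n Out M \<longleftrightarrow> finite Out \<and> (\<forall>x \<in> Out. psd_mat n (M x)) \<and>
     (\<forall>i < n. \<forall>j < n. (\<Sum>x \<in> Out. M x $$ (i, j)) = 1\<^sub>m n $$ (i, j))"

definition reduction_restricted :: "nat \<Rightarrow> nat set \<Rightarrow> (nat \<Rightarrow> complex mat) \<Rightarrow> bool" where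
  "reduction_restricted d Out M \<longleftrightarrow>
     (\<forall>x \<in> Out. 0 < mtrace (M x) \<longrightarrow>
        loewner_le (d * d) ((1 / mtrace (M x)) \<cdot>\<^sub>m M x)
          (1\<^sub>m d \<otimes>\<^sub>m ((1 / mtrace (M x)) \<cdot>\<^sub>m partial_trace_S d (M x))))"

text \<open>An adaptive protocol is given by the outcome sets \<open>Out h\<close> and the measurement operators
  \<open>M h x\<close> used after the outcome history \<open>h\<close> (oldest outcome first). Outcomes are labelled by
  natural numbers, which is no restriction since every POVM has finitely many outcomes.\<close>

definition records :: "(nat list \<Rightarrow> nat set) \<Rightarrow> nat \<Rightarrow> nat list set" where
  "records Out m = {h. length h = m \<and> (\<forall>k < m. h ! k \<in> Out (take k h))}"

definition copywise_protocol ::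
  "nat \<Rightarrow> nat \<Rightarrow> (nat list \<Rightarrow> nat set) \<Rightarrow> (nat list \<Rightarrow> nat \<Rightarrow> complex mat) \<Rightarrow> bool" where
  "copywise_protocol d N Out M \<longleftrightarrow>
     (\<forall>m < N. \<forall>h \<in> records Out m. is_povm (d * d) (Out h) (M h))"

definition reduction_restricted_protocol ::
  "nat \<Rightarrow> nat \<Rightarrow> (nat list \<Rightarrow> nat set) \<Rightarrow> (nat list \<Rightarrow> nat \<Rightarrow> complex mat) \<Rightarrow> bool" where
  "reduction_restricted_protocol d N Out M \<longleftrightarrow>
     (\<forall>m < N. \<forall>h \<in> records Out m. reduction_restricted d (Out h) (M h))"

text \<open>Born rule for each fresh copy of \<open>\<rho> \<otimes> \<rho>\<^sup>*\<close>. The traces are real, so taking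
  the real part only changes the type.\<close>

definition record_prob ::
  "(nat list \<Rightarrow> nat \<Rightarrow> complex mat) \<Rightarrow> complex mat \<Rightarrow> nat list \<Rightarrow> real" where
  "record_prob M \<rho> h =
     (\<Prod>k < length h. Re (mtrace (M (take k h) (h ! k) * (\<rho> \<otimes>\<^sub>m conj_mat \<rho>))))"

definition estimates_within ::
  "nat \<Rightarrow> real \<Rightarrow> complex mat \<Rightarrow> (nat \<Rightarrow> nat \<Rightarrow> complex) \<Rightarrow> bool" where
  "estimates_within d \<epsilon> \<rho> y \<longleftrightarrow>
     (\<forall>q < d. \<forall>p < d. cmod (y q p - amplitude d \<rho> q p) \<le> \<epsilon>)"

definition success_prob ::
  "nat \<Rightarrow> nat \<Rightarrow> (nat list \<Rightarrow> nat set) \<Rightarrow> (nat list \<Rightarrow> nat \<Rightarrow> complex mat) \<Rightarrow>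
   (nat list \<Rightarrow> nat \<Rightarrow> nat \<Rightarrow> complex) \<Rightarrow> real \<Rightarrow> complex mat \<Rightarrow> real" where
  "success_prob d N Out M est \<epsilon> \<rho> =
     (\<Sum>h \<in> {h \<in> records Out N. estimates_within d \<epsilon> \<rho> (est h)}. record_prob M \<rho> h)"

definition learns_amplitudes ::
  "nat \<Rightarrow> nat \<Rightarrow> (nat list \<Rightarrow> nat set) \<Rightarrow> (nat list \<Rightarrow> nat \<Rightarrow> complex mat) \<Rightarrow>
   (nat list \<Rightarrow> nat \<Rightarrow> nat \<Rightarrow> complex) \<Rightarrow> real \<Rightarrow> bool" where
  "learns_amplitudes d N Out M est \<epsilon> \<longleftrightarrow>
     (\<forall>\<rho>. density_operator d \<rho> \<longrightarrow> 2 / 3 \<le> success_prob d N Out M est \<epsilon> \<rho>)"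

end

theory Submission
  imports Defs "HOL-Analysis.Convex"
begin

text \<open>
  Le Cam's two-point method against the ensemble \<open>\<rho> = (I \<plusminus> \<eta> (u W + u\<^sup>* W\<^sup>\<dagger>)) / d\<close>, where \<open>W\<close>
  is a uniformly random nontrivial displacement operator up to phase and \<open>\<eta> = 9 \<epsilon> / 4\<close>.
  A successful protocol separates every member from the maximally mixed state.
  For an effect \<open>M\<close> the likelihood ratio is \<open>1 + z\<close> with \<open>z = \<plusminus> \<eta> x + \<eta>\<^sup>2 y\<close>. The sign cancels
  \<open>x\<close> to first order, so only the ensemble averages of \<open>x\<^sup>2\<close>, \<open>y\<^sup>2\<close> and \<open>y\<close> matter.
  Parseval on \<open>\<int>/d\<close> bounds the average of \<open>x\<^sup>2\<close> by \<open>O(1/d)\<close>. The operators \<open>W \<otimes> W\<^sup>*\<close> commute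
  and share an eigenbasis of maximally entangled states \<open>\<Phi>\<close>; the reduction criterion gives
  \<open>\<langle>\<Phi>|M|\<Phi>\<rangle> \<le> tr M / d\<close>, and Parseval again bounds the average of \<open>y\<^sup>2\<close> by \<open>O(1/d)\<close>, hence
  that of \<open>\<bar>y\<bar>\<close> by \<open>O(1/sqrt d)\<close>. With \<open>ln (1 + z) \<ge> z - 16 z\<^sup>2\<close> the averaged likelihood
  ratio of every record is at least \<open>1 - O(N \<eta>\<^sup>2 / sqrt d)\<close>, whatever the adaptivity.
\<close>

section \<open>Fourier analysis of the displacement operators\<close>

definition omega :: "nat \<Rightarrow> complex" where
  "omega d = cis (2 * pi / real d)"

text \<open>Entries of \<open>X^q Z^p\<close>, that is of \<open>D_{q,p}\<close> stripped of its
  phase. The second moments below depend on moduli only; the phase returns when amplitudes are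
  computed.\<close>

definition weyl :: "nat \<Rightarrow> nat \<Rightarrow> nat \<Rightarrow> nat \<Rightarrow> nat \<Rightarrow> complex" where
  "weyl d q p i j = (if i = (j + q) mod d then omega d ^ (j * p) else 0)"

lemma norm_omega [simp]: "cmod (omega d) = 1"
  by (simp add: omega_def)

lemma cnj_mult_norm_one: "cmod z = 1 \<Longrightarrow> z * cnj z = 1" "cmod z = 1 \<Longrightarrow> cnj z * z = 1"
  using complex_norm_square[of z] by (auto simp: mult.commute)

lemma omega_pow_d: "0 < d \<Longrightarrow> omega d ^ d = 1"
  by (simp add: omega_def DeMoivre)

lemma omega_pow_mod: "0 < d \<Longrightarrow> omega d ^ (n mod d) = omega d ^ n"
proof -
  assume d: "0 < d"
  have "omega d ^ n = omega d ^ (d * (n div d) + n mod d)" by simp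
  also have "\<dots> = omega d ^ (n mod d)"
    unfolding power_add power_mult omega_pow_d[OF d] by simp
  finally show ?thesis by simp
qed

lemma omega_pow_cong: "0 < d \<Longrightarrow> m mod d = n mod d \<Longrightarrow> omega d ^ m = omega d ^ n"
  by (metis omega_pow_mod)

lemma omega_pow_inj:
  assumes "j < d" "k < d" "omega d ^ j = omega d ^ k"
  shows "j = k"
proof -
  have "inj_on (\<lambda>k. cis (2 * pi * real k / real d)) {..<d}"
    using bij_betw_roots_unity[of d] assms(1) by (auto simp: bij_betw_def)
  moreover have "omega d ^ n = cis (2 * pi * real n / real d)" for n
    by (simp add: omega_def DeMoivre mult_ac)
  ultimately show ?thesis
    using assms unfolding inj_on_def by auto
qed

lemma omega_orthogonal:
  assumes "j < d" "k < d"
  shows "(\<Sum>p<d. omega d ^ (j * p) * cnj (omega d ^ (k * p))) = (if j = k then of_nat d else 0)"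
proof -
  define z where "z = omega d ^ j * cnj (omega d ^ k)"
  have d: "0 < d" using assms by simp
  have eq: "(\<Sum>p<d. omega d ^ (j * p) * cnj (omega d ^ (k * p))) = (\<Sum>p<d. z ^ p)"
    by (simp add: z_def power_mult power_mult_distrib)
  have kk: "omega d ^ k * cnj (omega d ^ k) = 1"
    by (rule cnj_mult_norm_one) (simp add: norm_power)
  show ?thesis
  proof (cases "j = k")
    case True
    then have "z = 1" using kk by (simp add: z_def)
    then show ?thesis using True eq by simp
  next
    case False
    have "z \<noteq> 1"
    proof
      assume "z = 1"
      then have "omega d ^ j * (omega d ^ k * cnj (omega d ^ k)) = omega d ^ k"
        unfolding z_def by (metis mult.left_commute mult.right_neutral)
      then have "omega d ^ j = omega d ^ k"
        unfolding kk by simp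
      then show False
        using omega_pow_inj[OF assms] False by simp
    qed
    have "z ^ d = (omega d ^ d) ^ j * cnj ((omega d ^ d) ^ k)"
      by (simp add: z_def power_mult_distrib power_mult[symmetric] mult.commute)
    then have "z ^ d = 1" by (simp add: omega_pow_d[OF d])
    then show ?thesis
      using \<open>z \<noteq> 1\<close> False eq by (simp add: sum_gp_strict)
  qed
qed

text \<open>Expand the square and use orthogonality of characters; the transform is unnormalised,
  hence the factor \<open>d\<close>.\<close>

lemma parseval:
  "(\<Sum>p<d. (cmod (\<Sum>j<d. f j * omega d ^ (j * p)))\<^sup>2) = real d * (\<Sum>j<d. (cmod (f j))\<^sup>2)"
proof -
  have "complex_of_real (\<Sum>p<d. (cmod (\<Sum>j<d. f j * omega d ^ (j * p)))\<^sup>2)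
      = (\<Sum>p<d. (\<Sum>j<d. f j * omega d ^ (j * p)) * (\<Sum>k<d. cnj (f k) * cnj (omega d ^ (k * p))))"
    unfolding of_real_sum complex_norm_square by simp
  also have "\<dots> = (\<Sum>p<d. \<Sum>j<d. \<Sum>k<d. (f j * cnj (f k)) * (omega d ^ (j * p) * cnj (omega d ^ (k * p))))"
    unfolding sum_product by (intro sum.cong refl) (simp add: mult_ac)
  also have "\<dots> = (\<Sum>j<d. \<Sum>p<d. \<Sum>k<d. (f j * cnj (f k)) * (omega d ^ (j * p) * cnj (omega d ^ (k * p))))"
    by (rule sum.swap)
  also have "\<dots> = (\<Sum>j<d. \<Sum>k<d. \<Sum>p<d. (f j * cnj (f k)) * (omega d ^ (j * p) * cnj (omega d ^ (k * p))))"
    by (rule sum.cong[OF refl], rule sum.swap)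
  also have "\<dots> = (\<Sum>j<d. \<Sum>k<d. (f j * cnj (f k)) * (if j = k then of_nat d else 0))"
    unfolding sum_distrib_left[symmetric]
    by (intro sum.cong refl) (simp add: omega_orthogonal del: complex_cnj_power)
  also have "\<dots> = (\<Sum>j<d. \<Sum>k<d. if j = k then (f j * cnj (f k)) * of_nat d else 0)"
    by (intro sum.cong refl) auto
  also have "\<dots> = (\<Sum>j<d. (f j * cnj (f j)) * of_nat d)"
    by (intro sum.cong refl) (subst sum.delta', auto)
  also have "\<dots> = complex_of_real (real d * (\<Sum>j<d. (cmod (f j))\<^sup>2))"
    by (simp add: complex_norm_square sum_distrib_left mult_ac del: of_real_power)
  finally show ?thesis by (simp only: of_real_eq_iff)
qed

section \<open>Cyclic bijections and flattened bipartite indices\<close>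

lemma bij_add_mod: "bij_betw (\<lambda>r. (k + r) mod d) {..<d} {..<(d::nat)}"
proof -
  have inj: "inj_on (\<lambda>r. (k + r) mod d) {..<d}"
  proof (rule inj_onI)
    fix x y assume "x \<in> {..<d}" "y \<in> {..<d}" "(k + x) mod d = (k + y) mod d"
    \<comment> \<open>The detour through the integers lets \<open>k\<close> be subtracted from both
      sides of the congruence.\<close>
    moreover from this have "int (k + x) mod int d = int (k + y) mod int d"
      by (simp only: zmod_int[symmetric])
    then have "x mod d = y mod d"
      using mod_diff_cong[of "int (k + x)" "int d" "int (k + y)" "int k" "int k"]
      by (simp add: zmod_int[symmetric])
    ultimately show "x = y" by simp
  qed
  moreover have "(\<lambda>r. (k + r) mod d) ` {..<d} \<subseteq> {..<d}" by auto
  ultimately have "(\<lambda>r. (k + r) mod d) ` {..<d} = {..<d}"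
    by (intro endo_inj_surj) auto
  with inj show ?thesis by (simp add: bij_betw_def)
qed

lemma sum_shift:
  "(\<Sum>r<d. g ((k + r) mod d)) = (\<Sum>r<d. g r)" for d :: nat
  using sum.reindex_bij_betw[OF bij_add_mod, of g] by blast

lemma bij_diff_mod: "bij_betw (\<lambda>r. (r + (d - k)) mod d) {..<d} {..<(d::nat)}"
  using bij_add_mod[of "d - k"] by (simp add: add.commute)

text \<open>The reflection \<open>k -> r - k\<close> modulo \<open>d\<close> is the reversal
  \<open>k -> d - 1 - k\<close> followed by the shift by \<open>r + 1\<close>; for
  \<open>k < d\<close> no subtraction is truncated.\<close>

lemma bij_reflect_mod: "bij_betw (\<lambda>k. (r + (d - k)) mod d) {..<d} {..<(d::nat)}"
proof -
  have "bij_betw (\<lambda>k. d - Suc k) {..<d} {..<d}"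
    by (rule bij_betw_byWitness[where f' = "\<lambda>k. d - Suc k"]) auto
  from bij_betw_trans[OF this bij_add_mod[of "Suc r"]]
  show ?thesis
    by (rule bij_betw_cong[THEN iffD1, rotated]) (auto simp: Suc_diff_Suc)
qed

lemma sum_lessThan_square:
  "(\<Sum>i<d * d. f i) = (\<Sum>s<d. \<Sum>a<d. f (s * d + a))" for d :: nat
proof -
  have "(\<Sum>i<d * d. f i) = (\<Sum>s<d. sum f {s * d..<s * d + d})"
    by (simp add: sum.nat_group)
  also have "\<dots> = (\<Sum>s<d. \<Sum>a<d. f (s * d + a))"
    by (rule sum.cong[OF refl])
      (simp add: sum.atLeastLessThan_shift_0[of f] atLeast0LessThan)
  finally show ?thesis .
qed

lemma index_less: "s < d \<Longrightarrow> a < d \<Longrightarrow> s * d + a < d * (d::nat)"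
proof -
  assume "s < d" "a < d"
  then have "s * d + a < Suc s * d" by simp
  also have "\<dots> \<le> d * d" using \<open>s < d\<close> by (intro mult_le_mono1) simp
  finally show ?thesis .
qed

section \<open>Matrix entries, unitarity and trace of the displacement operators\<close>

lemma shift_pow:
  assumes "i < d" "j < d"
  shows "(shift_mat d ^\<^sub>m q) $$ (i, j) = (if i = (j + q) mod d then 1 else 0)"
  using assms
proof (induction q arbitrary: i j)
  case 0
  then show ?case by (simp add: shift_mat_def)
next
  case (Suc q)
  have "(shift_mat d ^\<^sub>m Suc q) $$ (i, j)
    = (\<Sum>k<d. (shift_mat d ^\<^sub>m q) $$ (i, k) * shift_mat d $$ (k, j))"
    using Suc.prems by (simp add: scalar_prod_def shift_mat_def atLeast0LessThan)
  also have "\<dots> = (\<Sum>k<d. if k = (j + 1) mod d then (if i = (k + q) mod d then 1 else 0) else 0)"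
    using Suc by (intro sum.cong refl) (simp add: shift_mat_def)
  also have "\<dots> = (if i = (j + Suc q) mod d then 1 else 0)"
    using Suc.prems by (simp add: sum.delta mod_add_left_eq)
  finally show ?case .
qed

lemma clock_pow:
  assumes "i < d" "j < d"
  shows "(clock_mat d ^\<^sub>m p) $$ (i, j) = (if i = j then omega d ^ (j * p) else 0)"
  using assms
proof (induction p arbitrary: i j)
  case 0
  then show ?case by (simp add: clock_mat_def)
next
  case (Suc p)
  have ex: "exp (2 * complex_of_real pi * \<i> * of_nat j / of_nat d) = omega d ^ j"
    unfolding omega_def DeMoivre unfolding cis_conv_exp by (simp add: mult_ac)
  have "(clock_mat d ^\<^sub>m Suc p) $$ (i, j)
    = (\<Sum>k<d. (clock_mat d ^\<^sub>m p) $$ (i, k) * clock_mat d $$ (k, j))"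
    using Suc.prems by (simp add: scalar_prod_def clock_mat_def atLeast0LessThan)
  also have "\<dots> = (\<Sum>k<d. if k = j then (if i = k then omega d ^ (k * p) else 0) * omega d ^ j else 0)"
    using Suc ex by (intro sum.cong refl) (auto simp: clock_mat_def)
  also have "\<dots> = (if i = j then omega d ^ (j * Suc p) else 0)"
    using Suc.prems by (simp add: sum.delta power_add mult.commute)
  finally show ?case .
qed

definition phase :: "nat \<Rightarrow> nat \<Rightarrow> nat \<Rightarrow> complex" where
  "phase d q p = exp (\<i> * complex_of_real pi * of_nat q * of_nat p / of_nat d)"

lemma norm_phase: "cmod (phase d q p) = 1"
proof -
  have "phase d q p = cis (pi * real q * real p / real d)"
    by (simp add: phase_def cis_conv_exp mult_ac)
  then show ?thesis by simp
qed

lemma displacement_carrier: "displacement d q p \<in> carrier_mat d d"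
  unfolding displacement_def
  by (intro smult_carrier_mat mult_carrier_mat[of _ d d] pow_carrier_mat)
    (simp_all add: shift_mat_def clock_mat_def)

lemma displacement_index:
  assumes "i < d" "j < d"
  shows "displacement d q p $$ (i, j) = phase d q p * weyl d q p i j"
proof -
  have "displacement d q p $$ (i, j) = phase d q p *
     (\<Sum>k<d. (shift_mat d ^\<^sub>m q) $$ (i, k) * (clock_mat d ^\<^sub>m p) $$ (k, j))"
    using assms by (simp add: displacement_def phase_def scalar_prod_def shift_mat_def clock_mat_def atLeast0LessThan)
  also have "\<dots> = phase d q p * (\<Sum>k<d. if k = j then (if i = (k + q) mod d then omega d ^ (k * p) else 0) else 0)"
    using assms by (intro arg_cong2[of _ _ _ _ "(*)"] sum.cong refl) (auto simp: shift_pow clock_pow)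
  also have "\<dots> = phase d q p * weyl d q p i j"
    using assms by (simp add: sum.delta weyl_def)
  finally show ?thesis .
qed

text \<open>Each column of \<open>X^q Z^p\<close> has one nonzero entry, so contracting with it
  turns a double sum into a sum along a cyclic diagonal.\<close>

lemma sum_weyl_left:
  assumes "s < d"
  shows "(\<Sum>t<d. g t * weyl d q p t s) = g ((s + q) mod d) * omega d ^ (s * p)"
proof -
  have "(\<Sum>t<d. g t * weyl d q p t s) = (\<Sum>t<d. if t = (s + q) mod d then g t * omega d ^ (s * p) else 0)"
    by (intro sum.cong) (auto simp: weyl_def)
  then show ?thesis using assms by (simp add: sum.delta)
qed

lemma weyl_unitary:
  assumes "i < d" "j < d"
  shows "(\<Sum>k<d. weyl d q p i k * cnj (weyl d q p j k)) = (if i = j then 1 else 0)"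
proof -
  have one: "omega d ^ n * cnj (omega d ^ n) = 1" for n
    by (rule cnj_mult_norm_one) (simp add: norm_power)
  have "(\<Sum>k<d. weyl d q p i k * cnj (weyl d q p j k))
    = (\<Sum>k<d. (\<lambda>r. if i = r \<and> j = r then 1 else 0) ((q + k) mod d))"
    by (intro sum.cong refl) (auto simp: weyl_def one add.commute simp del: complex_cnj_power)
  also have "\<dots> = (\<Sum>r<d. if i = r \<and> j = r then 1 else 0)"
    by (rule sum_shift)
  also have "\<dots> = (\<Sum>r<d. if r = i then (if i = j then 1 else 0) else 0)"
    by (intro sum.cong refl) auto
  also have "\<dots> = (if i = j then 1 else 0)"
    using assms by (simp add: sum.delta)
  finally show ?thesis .
qed

text \<open>For \<open>q = 0\<close> the diagonal is a nontrivial character and sums to zero;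
  otherwise the shift has no fixed point and the diagonal vanishes.\<close>

lemma weyl_trace:
  assumes "q < d" "p < d" "(q, p) \<noteq> (0, 0)"
  shows "(\<Sum>j<d. weyl d q p j j) = 0"
proof (cases "q = 0")
  case True
  have "(\<Sum>j<d. weyl d q p j j) = (\<Sum>j<d. omega d ^ (p * j) * cnj (omega d ^ (0 * j)))"
    using True by (intro sum.cong refl) (auto simp: weyl_def mult.commute)
  also have "\<dots> = 0"
    using omega_orthogonal[of p d 0] assms True by simp
  finally show ?thesis .
next
  case False
  have "j \<noteq> (j + q) mod d" if "j < d" for j
    using that False assms(1) by (cases "j + q < d") (auto simp: mod_if)
  then show ?thesis by (intro sum.neutral) (auto simp: weyl_def)
qed

section \<open>Second moments of restricted effects\<close>

text \<open>The expectation \<open><w|M|w>\<close> on the bipartite space, with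
  \<open>m s a t b\<close> the entry of \<open>M\<close> in row \<open>(s, a)\<close> and column
  \<open>(t, b)\<close>.\<close>

definition qform ::
  "nat \<Rightarrow> (nat \<Rightarrow> nat \<Rightarrow> nat \<Rightarrow> nat \<Rightarrow> complex) \<Rightarrow> (nat \<Rightarrow> nat \<Rightarrow> complex) \<Rightarrow> complex" where
  "qform d m w = (\<Sum>s<d. \<Sum>a<d. \<Sum>t<d. \<Sum>b<d. m s a t b * w t b * cnj (w s a))"

text \<open>Cauchy-Schwarz in the form that carries the 2x2 minor inequalities of a bipartite
  operator over to its partial traces.\<close>

lemma norm_sum_sq_le:
  assumes "\<And>x. x \<in> S \<Longrightarrow> (cmod (f x))\<^sup>2 \<le> \<alpha> x * \<beta> x"
    and "\<And>x. x \<in> S \<Longrightarrow> 0 \<le> \<alpha> x" "\<And>x. x \<in> S \<Longrightarrow> 0 \<le> \<beta> x"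
  shows "(cmod (\<Sum>x\<in>S. f x))\<^sup>2 \<le> (\<Sum>x\<in>S. \<alpha> x) * (\<Sum>x\<in>S. \<beta> x)"
proof -
  have "cmod (f x) \<le> sqrt (\<alpha> x) * sqrt (\<beta> x)" if "x \<in> S" for x
    using real_le_rsqrt[OF assms(1)[OF that]] by (simp add: real_sqrt_mult)
  then have "cmod (\<Sum>x\<in>S. f x) \<le> (\<Sum>x\<in>S. sqrt (\<alpha> x) * sqrt (\<beta> x))"
    by (intro order_trans[OF norm_sum] sum_mono)
  then have "(cmod (\<Sum>x\<in>S. f x))\<^sup>2 \<le> (\<Sum>x\<in>S. sqrt (\<alpha> x) * sqrt (\<beta> x))\<^sup>2"
    by (intro power_mono) auto
  also have "\<dots> \<le> (\<Sum>x\<in>S. (sqrt (\<alpha> x))\<^sup>2) * (\<Sum>x\<in>S. (sqrt (\<beta> x))\<^sup>2)"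
    by (rule Cauchy_Schwarz_ineq_sum)
  also have "\<dots> = (\<Sum>x\<in>S. \<alpha> x) * (\<Sum>x\<in>S. \<beta> x)"
    using assms(2,3) by simp
  finally show ?thesis .
qed

text \<open>For fixed \<open>q\<close> the trace against \<open>X^q Z^p\<close> is the Fourier
  transform in \<open>p\<close> of the \<open>q\<close>-th cyclic diagonal of \<open>T\<close>.
  Parseval turns the sum into \<open>d\<close> times the squared Hilbert-Schmidt norm, and the minor
  inequality bounds that norm by the trace.\<close>

lemma weyl_moment:
  assumes "\<And>s t. s < d \<Longrightarrow> t < d \<Longrightarrow> (cmod (T s t))\<^sup>2 \<le> D s * D t"
  shows "(\<Sum>q<d. \<Sum>p<d. (cmod (\<Sum>s<d. \<Sum>t<d. T s t * weyl d q p t s))\<^sup>2)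
    \<le> real d * (\<Sum>s<d. D s)\<^sup>2"
proof -
  have "(\<Sum>q<d. \<Sum>p<d. (cmod (\<Sum>s<d. \<Sum>t<d. T s t * weyl d q p t s))\<^sup>2)
    = (\<Sum>q<d. \<Sum>p<d. (cmod (\<Sum>s<d. T s ((s + q) mod d) * omega d ^ (s * p)))\<^sup>2)"
    by (simp add: sum_weyl_left)
  also have "\<dots> = real d * (\<Sum>q<d. \<Sum>s<d. (cmod (T s ((s + q) mod d)))\<^sup>2)"
    by (simp add: parseval sum_distrib_left)
  also have "(\<Sum>q<d. \<Sum>s<d. (cmod (T s ((s + q) mod d)))\<^sup>2)
      = (\<Sum>s<d. \<Sum>q<d. (cmod (T s ((s + q) mod d)))\<^sup>2)"
    by (rule sum.swap)
  also have "\<dots> = (\<Sum>s<d. \<Sum>t<d. (cmod (T s t))\<^sup>2)"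
    by (rule sum.cong[OF refl], rule sum_shift)
  also have "real d * \<dots> \<le> real d * (\<Sum>s<d. \<Sum>t<d. D s * D t)"
    using assms by (intro mult_left_mono sum_mono) auto
  also have "\<dots> = real d * (\<Sum>s<d. D s)\<^sup>2"
    by (simp add: power2_eq_square sum_product)
  finally show ?thesis .
qed

text \<open>The numbers \<open>P t\<close> are the Fourier transform of the cyclic diagonal sums of \<open>N\<close>, so a bound on
  each \<open>P t\<close> controls the sum of squares by the sum, which is the trace.\<close>

lemma circulant_moment:
  fixes d :: nat and N :: "nat \<Rightarrow> nat \<Rightarrow> complex"
  defines "P \<equiv> \<lambda>t. \<Sum>k<d. \<Sum>l<d. N k l * omega d ^ (t * l) * cnj (omega d ^ (t * k))"
  assumes d: "0 < d"
    and bounds: "\<And>t. 0 \<le> Re (P t)" "\<And>t. Re (P t) \<le> \<tau>" "\<And>t. Im (P t) = 0"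
  shows "(\<Sum>q<d. (cmod (\<Sum>k<d. N k ((k + q) mod d)))\<^sup>2) \<le> \<tau> * (\<Sum>k<d. Re (N k k))"
proof -
  define g where "g q = (\<Sum>k<d. N k ((k + q) mod d))" for q
  have one: "omega d ^ n * cnj (omega d ^ n) = 1" for n
    by (rule cnj_mult_norm_one) (simp add: norm_power)
  have shift: "omega d ^ (t * ((k + q) mod d)) = omega d ^ (t * k) * omega d ^ (q * t)" for t k q
    unfolding power_add[symmetric]
    by (rule omega_pow_cong[OF d]) (simp add: mod_mult_right_eq algebra_simps)
  \<comment> \<open>Substituting \<open>l = k + q\<close> leaves a phase that depends on
    \<open>q\<close> and \<open>t\<close> only, so a diagonal contributes through its sum
    \<open>g q\<close> alone.\<close>
  have P: "P t = (\<Sum>q<d. g q * omega d ^ (q * t))" for t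
  proof -
    have "P t = (\<Sum>k<d. \<Sum>q<d. N k ((k + q) mod d) * omega d ^ (t * ((k + q) mod d)) * cnj (omega d ^ (t * k)))"
      unfolding P_def by (intro sum.cong[OF refl] sum_shift[symmetric])
    also have "\<dots> = (\<Sum>k<d. \<Sum>q<d. N k ((k + q) mod d) * omega d ^ (q * t))"
    proof (intro sum.cong refl)
      fix k q
      have "N k ((k + q) mod d) * omega d ^ (t * ((k + q) mod d)) * cnj (omega d ^ (t * k))
        = N k ((k + q) mod d) * omega d ^ (q * t) * (omega d ^ (t * k) * cnj (omega d ^ (t * k)))"
        unfolding shift by (simp only: mult_ac)
      then show "N k ((k + q) mod d) * omega d ^ (t * ((k + q) mod d)) * cnj (omega d ^ (t * k))
        = N k ((k + q) mod d) * omega d ^ (q * t)"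
        unfolding one by simp
    qed
    also have "\<dots> = (\<Sum>q<d. \<Sum>k<d. N k ((k + q) mod d) * omega d ^ (q * t))"
      by (rule sum.swap)
    finally show ?thesis by (simp add: g_def sum_distrib_right)
  qed
  \<comment> \<open>Summing over \<open>t\<close> isolates the main diagonal; \<open>0 * t\<close>
    is the trivial character against which \<open>q\<close> is tested.\<close>
  have "(\<Sum>t<d. P t) = (\<Sum>q<d. g q * (\<Sum>t<d. omega d ^ (q * t) * cnj (omega d ^ (0 * t))))"
    unfolding P by (subst sum.swap) (simp add: sum_distrib_left)
  also have "\<dots> = (\<Sum>q<d. if q = 0 then g q * of_nat d else 0)"
    using d by (intro sum.cong refl, subst omega_orthogonal) auto
  also have "\<dots> = of_nat d * (\<Sum>k<d. N k k)"
    using d by (simp add: g_def)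
  finally have trP: "(\<Sum>t<d. Re (P t)) = real d * (\<Sum>k<d. Re (N k k))"
    by (simp flip: Re_sum)
  have "real d * (\<Sum>q<d. (cmod (g q))\<^sup>2) = (\<Sum>t<d. (cmod (P t))\<^sup>2)"
    unfolding P by (rule parseval[symmetric])
  also have "\<dots> = (\<Sum>t<d. Re (P t) * Re (P t))"
    by (simp add: cmod_power2 bounds(3) flip: power2_eq_square)
  also have "\<dots> \<le> (\<Sum>t<d. \<tau> * Re (P t))"
    using bounds by (intro sum_mono mult_right_mono) auto
  also have "\<dots> = real d * (\<tau> * (\<Sum>k<d. Re (N k k)))"
    by (simp add: sum_distrib_left[symmetric] trP)
  finally show ?thesis using d by (simp add: g_def)
qed

text \<open>The reduction criterion is multiplied by \<open>tr M\<close>, so that it also makes sense for \<open>M = 0\<close>.\<close>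

locale bipartite_effect =
  fixes d :: nat and m :: "nat \<Rightarrow> nat \<Rightarrow> nat \<Rightarrow> nat \<Rightarrow> complex"
  assumes d_pos: "0 < d"
    and herm: "\<And>s a t b. s < d \<Longrightarrow> a < d \<Longrightarrow> t < d \<Longrightarrow> b < d \<Longrightarrow> m t b s a = cnj (m s a t b)"
    and qform_nonneg: "\<And>w. 0 \<le> qform d m w"
    and diag_nonneg: "\<And>s a. s < d \<Longrightarrow> a < d \<Longrightarrow> 0 \<le> Re (m s a s a)"
    and minor: "\<And>s a t b. s < d \<Longrightarrow> a < d \<Longrightarrow> t < d \<Longrightarrow> b < d \<Longrightarrow>
      (cmod (m s a t b))\<^sup>2 \<le> Re (m s a s a) * Re (m t b t b)"
    and reduction: "\<And>w. Re (qform d m w) \<le>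
      Re (\<Sum>s<d. \<Sum>a<d. \<Sum>b<d. (\<Sum>r<d. m r a r b) * w s b * cnj (w s a))"
begin

definition tr :: real where
  "tr = (\<Sum>s<d. \<Sum>a<d. Re (m s a s a))"

lemma tr_nonneg: "0 \<le> tr"
  unfolding tr_def by (intro sum_nonneg) (auto intro: diag_nonneg)

text \<open>The marginal on \<open>S\<close> inherits the minor inequality from \<open>M\<close>,
  and its diagonal sums to \<open>tr\<close>.\<close>

lemma moment_S:
  "(\<Sum>q<d. \<Sum>p<d. (cmod (\<Sum>s<d. \<Sum>t<d. (\<Sum>a<d. m s a t a) * weyl d q p t s))\<^sup>2) \<le> real d * tr\<^sup>2"
proof -
  have "(cmod (\<Sum>a<d. m s a t a))\<^sup>2 \<le> (\<Sum>a<d. Re (m s a s a)) * (\<Sum>a<d. Re (m t a t a))"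
    if "s < d" "t < d" for s t
    using that by (intro norm_sum_sq_le) (auto intro: diag_nonneg minor)
  from weyl_moment[of d "\<lambda>s t. \<Sum>a<d. m s a t a", OF this] show ?thesis
    by (simp add: tr_def)
qed

text \<open>The same for the transposed marginal on \<open>A\<close>; transposition preserves the
  minor inequality.\<close>

lemma moment_A:
  "(\<Sum>q<d. \<Sum>p<d. (cmod (\<Sum>b<d. \<Sum>a<d. (\<Sum>s<d. m s a s b) * weyl d q p a b))\<^sup>2) \<le> real d * tr\<^sup>2"
proof -
  have "(cmod (\<Sum>s<d. m s a s b))\<^sup>2 \<le> (\<Sum>s<d. Re (m s b s b)) * (\<Sum>s<d. Re (m s a s a))"
    if "b < d" "a < d" for a b
    using that by (subst mult.commute, intro norm_sum_sq_le) (auto intro: diag_nonneg minor)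
  from weyl_moment[of d "\<lambda>b a. \<Sum>s<d. m s a s b", OF this] show ?thesis
    unfolding tr_def by (subst (2) sum.swap) simp
qed

text \<open>Here \<open>P t\<close> is the expectation of \<open>M\<close> in the unnormalised maximally entangled vector
  with amplitudes \<open>omega d ^ (t * k)\<close> on \<open>|f k\<rangle> \<otimes> |k\<rangle>\<close>.\<close>

lemma graph_moment:
  fixes f :: "nat \<Rightarrow> nat"
  assumes f: "bij_betw f {..<d} {..<d}"
  shows "(\<Sum>q<d. (cmod (\<Sum>k<d. m (f k) k (f ((k + q) mod d)) ((k + q) mod d)))\<^sup>2)
    \<le> tr * (\<Sum>k<d. Re (m (f k) k (f k) k))"
proof (rule circulant_moment[OF d_pos])
  fix t
  define w where "w s a = (if s = f a then omega d ^ (t * a) else 0)" for s a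
  define P where "P = (\<Sum>k<d. \<Sum>l<d. m (f k) k (f l) l * omega d ^ (t * l) * cnj (omega d ^ (t * k)))"
  have fd: "f a < d" if "a < d" for a
    using f that by (auto simp: bij_betw_def)
  have finj: "f a = f b \<longleftrightarrow> a = b" if "a < d" "b < d" for a b
    using f that by (auto simp: bij_betw_def inj_on_def)
  have one: "omega d ^ n * cnj (omega d ^ n) = 1" for n
    by (rule cnj_mult_norm_one) (simp add: norm_power)
  have collapse: "(\<Sum>s<d. \<Sum>a<d. F s a * w s a) = (\<Sum>a<d. F (f a) a * omega d ^ (t * a))" for F
  proof -
    have "(\<Sum>s<d. \<Sum>a<d. F s a * w s a) = (\<Sum>a<d. \<Sum>s<d. F s a * w s a)"
      by (rule sum.swap)
    also have "\<dots> = (\<Sum>a<d. \<Sum>s<d. if s = f a then F s a * omega d ^ (t * a) else 0)"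
      by (intro sum.cong refl) (simp add: w_def)
    also have "\<dots> = (\<Sum>a<d. F (f a) a * omega d ^ (t * a))"
      by (intro sum.cong refl) (simp add: fd)
    finally show ?thesis .
  qed
  have collapse': "(\<Sum>s<d. \<Sum>a<d. F s a * cnj (w s a)) = (\<Sum>a<d. F (f a) a * cnj (omega d ^ (t * a)))" for F
    using arg_cong[OF collapse[of "\<lambda>s a. cnj (F s a)"], of cnj] by simp
  have "qform d m w = (\<Sum>s<d. \<Sum>a<d. (\<Sum>t<d. \<Sum>b<d. m s a t b * w t b) * cnj (w s a))"
    unfolding qform_def by (simp add: sum_distrib_right)
  also have "\<dots> = P"
    unfolding collapse collapse' P_def by (simp add: sum_distrib_right)
  finally have Pq: "P = qform d m w" ..
  show "0 \<le> Re P" "Im P = 0"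
    using qform_nonneg[of w] unfolding Pq by (auto simp: less_eq_complex_def)
  \<comment> \<open>On the right of the reduction bound both copies of \<open>w\<close> carry the
    same \<open>s\<close>. Injectivity of \<open>f\<close> then forces \<open>a = b\<close>, and
    unimodular amplitudes leave the trace. Since \<open>w\<close> has squared norm \<open>d\<close>,
    this is the bound \<open>tr / d\<close> for the normalised vector.\<close>
  have "(\<Sum>s<d. \<Sum>a<d. \<Sum>b<d. (\<Sum>r<d. m r a r b) * w s b * cnj (w s a))
    = (\<Sum>s<d. \<Sum>a<d. (\<Sum>b<d. (\<Sum>r<d. m r a r b) * w s b) * cnj (w s a))"
    by (simp add: sum_distrib_right)
  also have "\<dots> = (\<Sum>a<d. (\<Sum>b<d. (\<Sum>r<d. m r a r b) * w (f a) b) * cnj (omega d ^ (t * a)))"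
    by (rule collapse')
  also have "\<dots> = (\<Sum>a<d. (\<Sum>b<d. if b = a then (\<Sum>r<d. m r a r b) * omega d ^ (t * b) else 0) * cnj (omega d ^ (t * a)))"
    by (intro sum.cong refl arg_cong2[of _ _ _ _ "(*)"]) (auto simp: w_def finj)
  also have "\<dots> = (\<Sum>a<d. (\<Sum>r<d. m r a r a) * (omega d ^ (t * a) * cnj (omega d ^ (t * a))))"
    by (simp add: mult.assoc)
  also have "\<dots> = (\<Sum>a<d. \<Sum>r<d. m r a r a)"
    unfolding one by simp
  finally have "Re (qform d m w) \<le> Re (\<Sum>a<d. \<Sum>r<d. m r a r a)"
    using reduction[of w] by simp
  also have "Re (\<Sum>a<d. \<Sum>r<d. m r a r a) = tr"
    unfolding tr_def by (subst sum.swap) simp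
  finally show "Re P \<le> tr" unfolding Pq .
qed

text \<open>The graphs of \<open>f r\<close> for \<open>r < d\<close> partition the basis pairs, so
  the partial traces on the right of the single-graph bounds add up to \<open>tr\<close>.\<close>

lemma latin_moment:
  fixes f :: "nat \<Rightarrow> nat \<Rightarrow> nat"
  assumes row: "\<And>r. bij_betw (f r) {..<d} {..<d}"
    and col: "\<And>k. bij_betw (\<lambda>r. f r k) {..<d} {..<d}"
  shows "(\<Sum>r<d. \<Sum>q<d. (cmod (\<Sum>k<d. m (f r k) k (f r ((k + q) mod d)) ((k + q) mod d)))\<^sup>2) \<le> tr\<^sup>2"
proof -
  have "(\<Sum>r<d. \<Sum>q<d. (cmod (\<Sum>k<d. m (f r k) k (f r ((k + q) mod d)) ((k + q) mod d)))\<^sup>2)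
    \<le> (\<Sum>r<d. tr * (\<Sum>k<d. Re (m (f r k) k (f r k) k)))"
    by (intro sum_mono graph_moment row)
  also have "\<dots> = tr * (\<Sum>k<d. \<Sum>r<d. Re (m (f r k) k (f r k) k))"
    by (subst sum.swap) (simp add: sum_distrib_left)
  also have "(\<Sum>k<d. \<Sum>r<d. Re (m (f r k) k (f r k) k)) = (\<Sum>k<d. \<Sum>s<d. Re (m s k s k))"
    by (rule sum.cong[OF refl], rule sum.reindex_bij_betw[OF col])
  also have "\<dots> = tr"
    unfolding tr_def by (rule sum.swap)
  finally show ?thesis by (simp add: power2_eq_square)
qed

text \<open>Common frame for both conjugation patterns: Parseval over \<open>p\<close> reduces
  \<open>C\<close> to the graph sums. Only moduli are compared, so \<open>C\<close> may differ by a
  phase and \<open>G\<close> by conjugation.\<close>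

lemma moment_latin_fourier:
  fixes f :: "nat \<Rightarrow> nat \<Rightarrow> nat"
  assumes row: "\<And>r. bij_betw (f r) {..<d} {..<d}"
    and col: "\<And>k. bij_betw (\<lambda>r. f r k) {..<d} {..<d}"
    and C: "\<And>q p. q < d \<Longrightarrow> p < d \<Longrightarrow> cmod (C q p) = cmod (\<Sum>r<d. G r q * omega d ^ (r * p))"
    and G: "\<And>r q. r < d \<Longrightarrow> q < d \<Longrightarrow>
      cmod (G r q) = cmod (\<Sum>k<d. m (f r k) k (f r ((k + q) mod d)) ((k + q) mod d))"
  shows "(\<Sum>q<d. \<Sum>p<d. (cmod (C q p))\<^sup>2) \<le> real d * tr\<^sup>2"
proof -
  have "(\<Sum>q<d. \<Sum>p<d. (cmod (C q p))\<^sup>2) = (\<Sum>q<d. real d * (\<Sum>r<d. (cmod (G r q))\<^sup>2))"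
    by (simp add: C parseval)
  also have "\<dots> = real d * (\<Sum>r<d. \<Sum>q<d. (cmod (G r q))\<^sup>2)"
    by (subst sum.swap) (simp add: sum_distrib_left)
  also have "\<dots> \<le> real d * tr\<^sup>2"
    using latin_moment[OF row col] by (intro mult_left_mono) (simp_all add: G)
  finally show ?thesis .
qed

text \<open>Both registers are shifted by \<open>q\<close>, so the difference
  \<open>r = s - a\<close> is conserved and the two phases combine to the character
  \<open>r * p\<close>. The invariant blocks are the graphs of \<open>k -> k + r\<close>.\<close>

lemma moment_SA:
  "(\<Sum>q<d. \<Sum>p<d. (cmod (\<Sum>s<d. \<Sum>a<d. \<Sum>t<d. \<Sum>b<d.
      m s a t b * weyl d q p t s * cnj (weyl d q p b a)))\<^sup>2) \<le> real d * tr\<^sup>2"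
proof (rule moment_latin_fourier[where f = "\<lambda>r k. (k + r) mod d"
      and G = "\<lambda>r q. \<Sum>k<d. m ((k + r) mod d) k ((((k + q) mod d) + r) mod d) ((k + q) mod d)"])
  show "bij_betw (\<lambda>k. (k + r) mod d) {..<d} {..<d}" for r
    using bij_add_mod[of r d] by (simp add: add.commute)
  show "bij_betw (\<lambda>r. (k + r) mod d) {..<d} {..<d}" for k
    by (rule bij_add_mod)
  fix q p assume "q < d" "p < d"
  have one: "omega d ^ n * cnj (omega d ^ n) = 1" for n
    by (rule cnj_mult_norm_one) (simp add: norm_power)
  have shift: "omega d ^ (((k + r) mod d) * p) = omega d ^ (k * p) * omega d ^ (r * p)" for k r
    unfolding power_add[symmetric]
    by (rule omega_pow_cong[OF d_pos]) (simp only: mod_mult_left_eq add_mult_distrib[symmetric])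
  have inner: "(\<Sum>t<d. \<Sum>b<d. m s a t b * weyl d q p t s * cnj (weyl d q p b a))
     = m s a ((s + q) mod d) ((a + q) mod d) * omega d ^ (s * p) * cnj (omega d ^ (a * p))"
    if "s < d" "a < d" for s a
  proof -
    have *: "(\<Sum>b<d. x b * cnj (weyl d q p b a)) = x ((a + q) mod d) * cnj (omega d ^ (a * p))" for x
      using arg_cong[OF sum_weyl_left[OF that(2), of "\<lambda>b. cnj (x b)" q p], of cnj] by simp
    show ?thesis
      unfolding * sum_distrib_right[symmetric] sum_weyl_left[OF that(1)] ..
  qed
  have "(\<Sum>s<d. \<Sum>a<d. \<Sum>t<d. \<Sum>b<d. m s a t b * weyl d q p t s * cnj (weyl d q p b a))
    = (\<Sum>s<d. \<Sum>a<d. m s a ((s + q) mod d) ((a + q) mod d) * omega d ^ (s * p) * cnj (omega d ^ (a * p)))"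
    by (simp add: inner)
  also have "\<dots> = (\<Sum>a<d. \<Sum>s<d. m s a ((s + q) mod d) ((a + q) mod d) * omega d ^ (s * p) * cnj (omega d ^ (a * p)))"
    by (rule sum.swap)
  also have "\<dots> = (\<Sum>a<d. \<Sum>r<d. m ((a + r) mod d) a (((a + r) mod d + q) mod d) ((a + q) mod d)
      * omega d ^ (((a + r) mod d) * p) * cnj (omega d ^ (a * p)))"
    by (rule sum.cong[OF refl], rule sum_shift[symmetric])
  also have "\<dots> = (\<Sum>a<d. \<Sum>r<d. m ((a + r) mod d) a ((((a + q) mod d) + r) mod d) ((a + q) mod d) * omega d ^ (r * p))"
  proof (intro sum.cong refl)
    fix a r
    have "((a + r) mod d + q) mod d = (((a + q) mod d) + r) mod d"
      unfolding mod_add_left_eq by (simp only: ac_simps)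
    moreover have "omega d ^ (((a + r) mod d) * p) * cnj (omega d ^ (a * p)) = omega d ^ (r * p)"
      using one[of "a * p"] unfolding shift by (metis mult.commute mult.assoc mult.right_neutral)
    ultimately show "m ((a + r) mod d) a (((a + r) mod d + q) mod d) ((a + q) mod d)
        * omega d ^ (((a + r) mod d) * p) * cnj (omega d ^ (a * p))
      = m ((a + r) mod d) a ((((a + q) mod d) + r) mod d) ((a + q) mod d) * omega d ^ (r * p)"
      by (simp only: mult.assoc)
  qed
  also have "\<dots> = (\<Sum>r<d. (\<Sum>a<d. m ((a + r) mod d) a ((((a + q) mod d) + r) mod d) ((a + q) mod d)) * omega d ^ (r * p))"
    by (subst sum.swap) (simp add: sum_distrib_right)
  finally show "cmod (\<Sum>s<d. \<Sum>a<d. \<Sum>t<d. \<Sum>b<d. m s a t b * weyl d q p t s * cnj (weyl d q p b a))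
    = cmod (\<Sum>r<d. (\<Sum>k<d. m ((k + r) mod d) k ((((k + q) mod d) + r) mod d) ((k + q) mod d)) * omega d ^ (r * p))"
    by simp
qed simp

text \<open>Here the second factor is transposed and shifts the opposite way, so the sum
  \<open>r = s + a\<close> is conserved. The invariant blocks are the graphs of the reflections
  \<open>k -> r - k\<close>.\<close>

lemma moment_SA':
  "(\<Sum>q<d. \<Sum>p<d. (cmod (\<Sum>s<d. \<Sum>a<d. \<Sum>t<d. \<Sum>b<d.
      m s a t b * weyl d q p t s * weyl d q p a b))\<^sup>2) \<le> real d * tr\<^sup>2"
proof -
  define f where "f r k = (r + (d - k)) mod d" for r k
  have fd: "f r k < d" for r k using d_pos by (simp add: f_def)
  show ?thesis
  proof (rule moment_latin_fourier[where f = f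
      and G = "\<lambda>r q. \<Sum>b<d. m (f r ((b + q) mod d)) ((b + q) mod d) (f r b) b"])
    show "bij_betw (f r) {..<d} {..<d}" for r
      unfolding f_def by (rule bij_reflect_mod)
    show col: "bij_betw (\<lambda>r. f r k) {..<d} {..<d}" for k
      unfolding f_def by (rule bij_diff_mod)
    \<comment> \<open>The transposed factor makes the row index the shifted one; hermiticity
      identifies this with the conjugate of the standard graph sum.\<close>
    show "cmod (\<Sum>b<d. m (f r ((b + q) mod d)) ((b + q) mod d) (f r b) b)
      = cmod (\<Sum>k<d. m (f r k) k (f r ((k + q) mod d)) ((k + q) mod d))" for r q
    proof -
      have "(\<Sum>b<d. m (f r ((b + q) mod d)) ((b + q) mod d) (f r b) b)
        = cnj (\<Sum>k<d. m (f r k) k (f r ((k + q) mod d)) ((k + q) mod d))"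
        unfolding cnj_sum using d_pos by (intro sum.cong refl herm fd) auto
      then show ?thesis by (simp only: complex_mod_cnj)
    qed
    fix q p assume qp: "q < d" "p < d"
    have inner: "(\<Sum>a<d. \<Sum>t<d. m s a t b * weyl d q p t s * weyl d q p a b)
       = m s ((b + q) mod d) ((s + q) mod d) b * omega d ^ (s * p) * omega d ^ (b * p)"
      if "s < d" "b < d" for s b
    proof -
      have "(\<Sum>a<d. \<Sum>t<d. m s a t b * weyl d q p t s * weyl d q p a b)
        = (\<Sum>a<d. (\<Sum>t<d. m s a t b * weyl d q p t s) * weyl d q p a b)"
        by (simp add: sum_distrib_right)
      then show ?thesis
        unfolding sum_weyl_left[OF that(1)] sum_weyl_left[OF that(2)] .
    qed
    \<comment> \<open>Modulo \<open>d\<close> this is \<open>r - (b + q) + q = r - b\<close>; the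
      cases separate whether \<open>b + q\<close> wraps around, because subtraction on naturals
      truncates.\<close>
    have fq: "(f r ((b + q) mod d) + q) mod d = f r b" if "b < d" for r b
    proof (cases "b + q < d")
      case True
      then have "r + (d - (b + q)) + q = r + (d - b)" by simp
      then show ?thesis using True by (simp add: f_def mod_add_left_eq)
    next
      case False
      then have "(b + q) mod d = b + q - d"
        using that qp by (simp add: mod_if)
      moreover have "r + (d - (b + q - d)) + q = r + (d - b) + d"
        using False that qp by simp
      ultimately show ?thesis by (simp only: f_def mod_add_left_eq mod_add_self2)
    qed
    \<comment> \<open>With \<open>s = r - (b + q)\<close> the exponent \<open>(s + b) * p\<close>
      falls short of \<open>r * p\<close> by \<open>q * p\<close>. The missing factor is the same
      for all terms and unimodular, so multiplying by it does not change the modulus.\<close>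
    have ph: "omega d ^ (f r ((b + q) mod d) * p) * omega d ^ (b * p) * omega d ^ (q * p) = omega d ^ (r * p)"
      if "b < d" for r b
    proof -
      have "((f r ((b + q) mod d) + q) mod d + b) mod d = r mod d"
        unfolding fq[OF that] unfolding f_def using that by (simp add: mod_add_left_eq)
      then have "(f r ((b + q) mod d) + q + b) mod d = r mod d"
        by (simp add: mod_add_left_eq)
      then have "((f r ((b + q) mod d) + q + b) * p) mod d = (r * p) mod d"
        by (metis mod_mult_left_eq)
      then have "omega d ^ ((f r ((b + q) mod d) + q + b) * p) = omega d ^ (r * p)"
        by (rule omega_pow_cong[OF d_pos])
      moreover have "omega d ^ ((x + q + b) * p) = omega d ^ (x * p) * omega d ^ (b * p) * omega d ^ (q * p)" for x
        unfolding add_mult_distrib power_add by (simp only: mult_ac)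
      ultimately show ?thesis by simp
    qed
    let ?X = "\<Sum>s<d. \<Sum>a<d. \<Sum>t<d. \<Sum>b<d. m s a t b * weyl d q p t s * weyl d q p a b"
    have "?X = (\<Sum>s<d. \<Sum>a<d. \<Sum>b<d. \<Sum>t<d. m s a t b * weyl d q p t s * weyl d q p a b)"
      by (rule sum.cong[OF refl], rule sum.cong[OF refl], rule sum.swap)
    also have "\<dots> = (\<Sum>s<d. \<Sum>b<d. \<Sum>a<d. \<Sum>t<d. m s a t b * weyl d q p t s * weyl d q p a b)"
      by (rule sum.cong[OF refl], rule sum.swap)
    also have "\<dots> = (\<Sum>s<d. \<Sum>b<d. m s ((b + q) mod d) ((s + q) mod d) b * omega d ^ (s * p) * omega d ^ (b * p))"
      by (simp add: inner)
    also have "\<dots> = (\<Sum>b<d. \<Sum>s<d. m s ((b + q) mod d) ((s + q) mod d) b * omega d ^ (s * p) * omega d ^ (b * p))"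
      by (rule sum.swap)
    also have "\<dots> = (\<Sum>b<d. \<Sum>r<d. m (f r ((b + q) mod d)) ((b + q) mod d) ((f r ((b + q) mod d) + q) mod d) b
        * omega d ^ (f r ((b + q) mod d) * p) * omega d ^ (b * p))"
      by (rule sum.cong[OF refl], rule sum.reindex_bij_betw[OF col, symmetric])
    finally have X: "?X = \<dots>" .
    have "?X * omega d ^ (q * p) = (\<Sum>b<d. \<Sum>r<d. m (f r ((b + q) mod d)) ((b + q) mod d) (f r b) b * omega d ^ (r * p))"
    proof -
      have "z * omega d ^ (f r ((b + q) mod d) * p) * omega d ^ (b * p) * omega d ^ (q * p) = z * omega d ^ (r * p)"
        if "b < d" for z r b
        using ph[OF that, of r] by (simp only: mult.assoc)
      then show ?thesis
        unfolding X sum_distrib_right by (intro sum.cong refl) (simp add: fq)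
    qed
    also have "\<dots> = (\<Sum>r<d. (\<Sum>b<d. m (f r ((b + q) mod d)) ((b + q) mod d) (f r b) b) * omega d ^ (r * p))"
      by (subst sum.swap) (simp add: sum_distrib_right)
    finally have "cmod (?X * omega d ^ (q * p)) = cmod \<dots>" by simp
    then show "cmod ?X = cmod (\<Sum>r<d. (\<Sum>b<d. m (f r ((b + q) mod d)) ((b + q) mod d) (f r b) b) * omega d ^ (r * p))"
      by (simp add: norm_mult norm_power)
  qed
qed

end

section \<open>Effects as positive semidefinite matrices\<close>

lemma psd_form:
  assumes "psd_mat n A"
  shows "0 \<le> (\<Sum>i<n. \<Sum>j<n. A $$ (i, j) * v j * cnj (v i))"
proof -
  have "A \<in> carrier_mat n n" using assms by (simp add: psd_mat_def)
  then have "(A *\<^sub>v vec n v) \<bullet>c vec n v = (\<Sum>i<n. \<Sum>j<n. A $$ (i, j) * v j * cnj (v i))"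
    by (simp add: scalar_prod_def atLeast0LessThan sum_distrib_right)
  moreover have "0 \<le> (A *\<^sub>v vec n v) \<bullet>c vec n v"
    using assms by (simp add: psd_mat_def)
  ultimately show ?thesis by simp
qed

text \<open>Testing on \<open>x e_i + y e_j\<close> isolates a 2x2 principal block, from which
  hermiticity and the minor inequality are read off.\<close>

lemma psd_form_two:
  assumes "psd_mat n A" "i < n" "j < n" "i \<noteq> j"
  shows "0 \<le> A $$ (i, i) * x * cnj x + A $$ (i, j) * y * cnj x
    + A $$ (j, i) * x * cnj y + A $$ (j, j) * y * cnj y"
proof -
  define v where "v k = (if k = i then x else 0) + (if k = j then y else 0)" for k
  have one: "(\<Sum>k<n. g k * v k) = g i * x + g j * y" for g
    using assms by (simp add: v_def distrib_left sum.distrib if_distrib[of "\<lambda>z. g _ * z"] cong: if_cong)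
  have two: "(\<Sum>k<n. g k * cnj (v k)) = g i * cnj x + g j * cnj y" for g
    using arg_cong[OF one[of "\<lambda>k. cnj (g k)"], of cnj] by simp
  have "(\<Sum>k<n. \<Sum>l<n. A $$ (k, l) * v l * cnj (v k)) = (\<Sum>k<n. (\<Sum>l<n. A $$ (k, l) * v l) * cnj (v k))"
    by (simp add: sum_distrib_right)
  also have "\<dots> = A $$ (i, i) * x * cnj x + A $$ (i, j) * y * cnj x
    + A $$ (j, i) * x * cnj y + A $$ (j, j) * y * cnj y"
    unfolding one two by (simp add: algebra_simps)
  finally show ?thesis using psd_form[OF assms(1), of v] by simp
qed

lemma psd_diag:
  assumes "psd_mat n A" "i < n"
  shows "0 \<le> A $$ (i, i)"
proof -
  have "(\<Sum>k<n. \<Sum>l<n. A $$ (k, l) * (if l = i then 1 else 0) * cnj (if k = i then 1 else 0))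
    = (\<Sum>k<n. if k = i then (\<Sum>l<n. if l = i then A $$ (k, l) else 0) else 0)"
    by (rule sum.cong[OF refl]) (auto simp: if_distrib[of "\<lambda>z. _ * z"] cong: if_cong)
  also have "\<dots> = A $$ (i, i)"
    using assms(2) by simp
  finally show ?thesis
    using psd_form[OF assms(1), of "\<lambda>l. if l = i then 1 else 0"] by simp
qed

lemma psd_herm:
  assumes "psd_mat n A" "i < n" "j < n"
  shows "A $$ (j, i) = cnj (A $$ (i, j))"
proof (cases "i = j")
  case True
  then show ?thesis
    using psd_diag[OF assms(1,2)] by (auto simp: less_eq_complex_def complex_eq_iff)
next
  case False
  have "Im (A $$ (i, i)) = 0" "Im (A $$ (j, j)) = 0"
    using psd_diag[OF assms(1)] assms by (auto simp: less_eq_complex_def)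
  \<comment> \<open>The complex order forces the form to be real. At \<open>e_i + e_j\<close> this
    makes the imaginary parts of the two off-diagonal entries opposite, at
    \<open>e_i + i e_j\<close> it makes their real parts equal.\<close>
  then show ?thesis
    using psd_form_two[OF assms False, of 1 1] psd_form_two[OF assms False, of 1 \<i>]
    by (auto simp: less_eq_complex_def complex_eq_iff)
qed

lemma psd_minor:
  assumes "psd_mat n A" "i < n" "j < n"
  shows "(cmod (A $$ (i, j)))\<^sup>2 \<le> Re (A $$ (i, i)) * Re (A $$ (j, j))"
proof (cases "i = j")
  case True
  then show ?thesis
    using psd_diag[OF assms(1,2)] by (simp add: less_eq_complex_def cmod_power2 flip: power2_eq_square)
next
  case False
  define \<alpha> \<beta> \<gamma> where "\<alpha> = Re (A $$ (i, i))" and "\<beta> = Re (A $$ (j, j))" and "\<gamma> = A $$ (i, j)"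
  have nn: "0 \<le> \<alpha>" "0 \<le> \<beta>"
    using psd_diag[OF assms(1)] assms by (auto simp: less_eq_complex_def \<alpha>_def \<beta>_def)
  \<comment> \<open>The form at \<open>x e_i - y cnj \<gamma> e_j\<close>, a vector that makes the
    cross terms real. The choice \<open>x = \<beta>\<close>, \<open>y = 1\<close> yields
    \<open>\<beta>\<close> times the determinant.\<close>
  have key: "0 \<le> \<alpha> * x\<^sup>2 + \<beta> * y\<^sup>2 * (cmod \<gamma>)\<^sup>2 - 2 * x * y * (cmod \<gamma>)\<^sup>2" for x y :: real
  proof -
    have "0 \<le> Re (A $$ (i, i) * of_real x * cnj (of_real x)
      + A $$ (i, j) * (- of_real y * cnj \<gamma>) * cnj (of_real x)
      + A $$ (j, i) * of_real x * cnj (- of_real y * cnj \<gamma>)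
      + A $$ (j, j) * (- of_real y * cnj \<gamma>) * cnj (- of_real y * cnj \<gamma>))"
      using psd_form_two[OF assms False] by (simp only: less_eq_complex_def zero_complex.simps)
    also have "\<dots> = \<alpha> * x\<^sup>2 + \<beta> * y\<^sup>2 * (cmod \<gamma>)\<^sup>2 - 2 * x * y * (cmod \<gamma>)\<^sup>2"
      unfolding psd_herm[OF assms] \<gamma>_def[symmetric] cmod_power2
      by (simp add: \<alpha>_def \<beta>_def algebra_simps power2_eq_square)
    finally show ?thesis .
  qed
  have "(cmod \<gamma>)\<^sup>2 \<le> \<alpha> * \<beta>"
  proof (cases "\<beta> = 0")
    case False
    have "0 \<le> \<beta> * (\<alpha> * \<beta> - (cmod \<gamma>)\<^sup>2)"
      using key[of \<beta> 1] by (simp add: algebra_simps power2_eq_square)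
    then show ?thesis using False nn by (simp add: zero_le_mult_iff)
  next
    case True
    \<comment> \<open>With \<open>\<beta> = 0\<close> the form is affine in \<open>y\<close>, so a
      nonzero \<open>\<gamma>\<close> would let it reach the negative value
      \<open>\<alpha> - 2 (\<alpha> + 1)\<close>.\<close>
    have "\<gamma> = 0"
    proof (rule ccontr)
      assume "\<gamma> \<noteq> 0"
      then have "0 \<le> \<alpha> - 2 * (\<alpha> + 1)"
        using key[of 1 "(\<alpha> + 1) / (cmod \<gamma>)\<^sup>2"] True by simp
      then show False using nn by simp
    qed
    then show ?thesis using True by simp
  qed
  then show ?thesis by (simp add: \<alpha>_def \<beta>_def \<gamma>_def)
qed

section \<open>From matrices to four-index coefficients\<close>

definition effect_coeff :: "nat \<Rightarrow> complex mat \<Rightarrow> nat \<Rightarrow> nat \<Rightarrow> nat \<Rightarrow> nat \<Rightarrow> complex" where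
  "effect_coeff d M s a t b = M $$ (s * d + a, t * d + b)"

lemma psd_qform:
  assumes "psd_mat (d * d) M"
  shows "0 \<le> qform d (effect_coeff d M) w"
proof -
  have "(\<Sum>i<d * d. \<Sum>j<d * d. M $$ (i, j) * w (j div d) (j mod d) * cnj (w (i div d) (i mod d)))
    = qform d (effect_coeff d M) w"
    unfolding sum_lessThan_square qform_def effect_coeff_def by (intro sum.cong refl) auto
  then show ?thesis
    using psd_form[OF assms, of "\<lambda>j. w (j div d) (j mod d)"] by simp
qed

text \<open>A vanishing trace kills the diagonal and then, by the minors, every entry. This settles
  the outcomes about which the reduction criterion is silent.\<close>

lemma psd_zero_of_mtrace:
  assumes "psd_mat n M" "\<not> 0 < mtrace M" "i < n" "j < n"
  shows "M $$ (i, j) = 0"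
proof -
  have tr: "mtrace M = (\<Sum>i<n. M $$ (i, i))"
    using assms(1) by (auto simp: mtrace_def psd_mat_def)
  have "0 \<le> mtrace M"
    unfolding tr using psd_diag[OF assms(1)] by (intro sum_nonneg) auto
  with assms(2) have "(\<Sum>i<n. M $$ (i, i)) = 0"
    unfolding tr by simp
  then have "M $$ (i, i) = 0"
    using psd_diag[OF assms(1)] assms(3) by (subst (asm) sum_nonneg_eq_0_iff) auto
  then show ?thesis
    using psd_minor[OF assms(1,3,4)] by simp
qed

lemma bipartite_effect_coeff:
  assumes d: "0 < d" and psd: "psd_mat (d * d) M"
    and red: "0 < mtrace M \<Longrightarrow> loewner_le (d * d) ((1 / mtrace M) \<cdot>\<^sub>m M)
      (1\<^sub>m d \<otimes>\<^sub>m ((1 / mtrace M) \<cdot>\<^sub>m partial_trace_S d M))"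
  shows "bipartite_effect d (effect_coeff d M)"
proof (unfold_locales)
  fix w :: "nat \<Rightarrow> nat \<Rightarrow> complex"
  let ?m = "effect_coeff d M"
  let ?R = "\<Sum>s<d. \<Sum>a<d. \<Sum>b<d. (\<Sum>r<d. ?m r a r b) * w s b * cnj (w s a)"
  show "Re (qform d ?m w) \<le> Re ?R"
  proof (cases "0 < mtrace M")
    case False
    then have "?m s a t b = 0" if "s < d" "a < d" "t < d" "b < d" for s a t b
      using psd_zero_of_mtrace[OF psd] that by (simp add: effect_coeff_def index_less)
    then show ?thesis by (simp add: qform_def)
  next
    case True
    define T where "T = mtrace M"
    define B where "B = 1\<^sub>m d \<otimes>\<^sub>m ((1 / T) \<cdot>\<^sub>m partial_trace_S d M)"
    have T: "0 < T" using True by (simp add: T_def)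
    have M: "M \<in> carrier_mat (d * d) (d * d)" using psd by (simp add: psd_mat_def)
    have entry: "(B - (1 / T) \<cdot>\<^sub>m M) $$ (s * d + a, t * d + b)
      = (1 / T) * ((if s = t then (\<Sum>r<d. ?m r a r b) else 0) - ?m s a t b)"
      if "s < d" "a < d" "t < d" "b < d" for s a t b
      using that M d index_less[OF that(1,2)] index_less[OF that(3,4)]
      by (simp add: B_def tensor_mat_def partial_trace_S_def effect_coeff_def right_diff_distrib
          flip: sum_divide_distrib)
    have "psd_mat (d * d) (B - (1 / T) \<cdot>\<^sub>m M)"
      using red[OF True] by (simp add: loewner_le_def B_def T_def)
    from psd_form[OF this, of "\<lambda>j. w (j div d) (j mod d)"]
    have "0 \<le> (\<Sum>s<d. \<Sum>a<d. \<Sum>t<d. \<Sum>b<d. (1 / T) * ((if s = t then (\<Sum>r<d. ?m r a r b) else 0) - ?m s a t b)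
        * w t b * cnj (w s a))"
      unfolding sum_lessThan_square by (simp add: entry)
    also have "\<dots> = (1 / T) * ((\<Sum>s<d. \<Sum>a<d. \<Sum>t<d. \<Sum>b<d. (if s = t then (\<Sum>r<d. ?m r a r b) else 0) * w t b * cnj (w s a)) - qform d ?m w)"
      unfolding qform_def sum_subtractf[symmetric] sum_distrib_left
      by (intro sum.cong refl) (simp add: algebra_simps)
    also have "(\<Sum>s<d. \<Sum>a<d. \<Sum>t<d. \<Sum>b<d. (if s = t then (\<Sum>r<d. ?m r a r b) else 0) * w t b * cnj (w s a)) = ?R"
    proof (rule sum.cong[OF refl], rule sum.cong[OF refl])
      fix s a assume s: "s \<in> {..<d}"
      have "(\<Sum>t<d. \<Sum>b<d. (if s = t then (\<Sum>r<d. ?m r a r b) else 0) * w t b * cnj (w s a))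
        = (\<Sum>t<d. if t = s then (\<Sum>b<d. (\<Sum>r<d. ?m r a r b) * w t b * cnj (w s a)) else 0)"
        by (intro sum.cong refl) auto
      then show "(\<Sum>t<d. \<Sum>b<d. (if s = t then (\<Sum>r<d. ?m r a r b) else 0) * w t b * cnj (w s a))
        = (\<Sum>b<d. (\<Sum>r<d. ?m r a r b) * w s b * cnj (w s a))"
        using s by simp
    qed
    finally have nn: "0 \<le> (1 / T) * (?R - qform d ?m w)" .
    \<comment> \<open>Positivity in the complex order includes being real, so the factor
      \<open>1 / T\<close> can be cleared from the real part.\<close>
    have "T = complex_of_real (Re T)" "0 < Re T"
      using T by (auto simp: less_complex_def complex_eq_iff)
    then obtain t where t: "T = complex_of_real t" "0 < t" by blast
    have "0 \<le> Re ((1 / T) * (?R - qform d ?m w))"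
      using nn by (simp only: less_eq_complex_def zero_complex.simps)
    also have "\<dots> = Re (?R - qform d ?m w) / t"
      by (simp add: t(1))
    finally show ?thesis using t(2) by (simp add: zero_le_divide_iff)
  qed
next
  show "0 < d" by (rule d)
  show "0 \<le> qform d (effect_coeff d M) w" for w
    by (rule psd_qform[OF psd])
  fix s a assume sa: "s < d" "a < d"
  show "0 \<le> Re (effect_coeff d M s a s a)"
    using psd_diag[OF psd index_less[OF sa]] by (simp add: effect_coeff_def less_eq_complex_def)
  fix t b assume tb: "t < d" "b < d"
  show "effect_coeff d M t b s a = cnj (effect_coeff d M s a t b)"
    unfolding effect_coeff_def by (rule psd_herm[OF psd index_less[OF sa] index_less[OF tb]])
  show "(cmod (effect_coeff d M s a t b))\<^sup>2 \<le> Re (effect_coeff d M s a s a) * Re (effect_coeff d M t b t b)"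
    unfolding effect_coeff_def by (rule psd_minor[OF psd index_less[OF sa] index_less[OF tb]])
qed

text \<open>The trace of \<open>M\<close> against \<open>R\<close> tensored with the conjugate of
  \<open>S\<close>: linear in \<open>R\<close>, conjugate-linear in \<open>S\<close>. Separate
  arguments allow the Born probability to be expanded term by term.\<close>

definition overlap ::
  "nat \<Rightarrow> (nat \<Rightarrow> nat \<Rightarrow> nat \<Rightarrow> nat \<Rightarrow> complex) \<Rightarrow> (nat \<Rightarrow> nat \<Rightarrow> complex) \<Rightarrow> (nat \<Rightarrow> nat \<Rightarrow> complex) \<Rightarrow> complex" where
  "overlap d m R S = (\<Sum>s<d. \<Sum>a<d. \<Sum>t<d. \<Sum>b<d. m s a t b * R t s * cnj (S b a))"

lemma born_overlap:
  assumes M: "M \<in> carrier_mat (d * d) (d * d)"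
  shows "mtrace (M * (mat d d (\<lambda>(i, j). R i j) \<otimes>\<^sub>m conj_mat (mat d d (\<lambda>(i, j). R i j))))
    = overlap d (effect_coeff d M) R R"
proof -
  let ?\<rho> = "mat d d (\<lambda>(i, j). R i j)"
  have "mtrace (M * (?\<rho> \<otimes>\<^sub>m conj_mat ?\<rho>))
    = (\<Sum>i<d * d. \<Sum>j<d * d. M $$ (i, j) * (?\<rho> \<otimes>\<^sub>m conj_mat ?\<rho>) $$ (j, i))"
    using M by (simp add: mtrace_def scalar_prod_def atLeast0LessThan tensor_mat_def conj_mat_def)
  also have "\<dots> = overlap d (effect_coeff d M) R R"
    unfolding sum_lessThan_square overlap_def
    by (intro sum.cong refl) (simp add: effect_coeff_def tensor_mat_def conj_mat_def index_less mult.assoc)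
  finally show ?thesis .
qed

lemma overlap_lin_left:
  "overlap d m (\<lambda>i j. x * R i j + y * R' i j) S = x * overlap d m R S + y * overlap d m R' S"
proof -
  have "c * (x * R t s + y * R' t s) * e = x * (c * R t s * e) + y * (c * R' t s * e)" for c e t s
    by (simp add: algebra_simps)
  then show ?thesis
    by (simp only: overlap_def sum.distrib sum_distrib_left)
qed

lemma overlap_lin_right:
  "overlap d m R (\<lambda>i j. x * S i j + y * S' i j) = cnj x * overlap d m R S + cnj y * overlap d m R S'"
proof -
  have "c * cnj (x * S t s + y * S' t s) = cnj x * (c * cnj (S t s)) + cnj y * (c * cnj (S' t s))" for c t s
    by (simp add: algebra_simps)
  then show ?thesis
    by (simp only: overlap_def sum.distrib sum_distrib_left)
qed

lemma overlap_sum_left: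
  assumes "finite K"
  shows "overlap d m (\<lambda>i j. \<Sum>k\<in>K. R k i j) S = (\<Sum>k\<in>K. overlap d m (R k) S)"
  using assms
proof (induction rule: finite_induct)
  case empty
  show ?case by (simp add: overlap_def)
next
  case (insert k K)
  then show ?case
    using overlap_lin_left[of d m 1 "R k" 1 "\<lambda>i j. \<Sum>k\<in>K. R k i j" S] by simp
qed

lemma overlap_sum_right:
  assumes "finite K"
  shows "overlap d m R (\<lambda>i j. \<Sum>k\<in>K. S k i j) = (\<Sum>k\<in>K. overlap d m R (S k))"
  using assms
proof (induction rule: finite_induct)
  case empty
  show ?case by (simp add: overlap_def)
next
  case (insert k K)
  then show ?case
    using overlap_lin_right[of d m R 1 "S k" 1 "\<lambda>i j. \<Sum>k\<in>K. S k i j"] by simp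
qed

lemma overlap_cong:
  assumes "\<And>i j. i < d \<Longrightarrow> j < d \<Longrightarrow> R i j = R' i j" "\<And>i j. i < d \<Longrightarrow> j < d \<Longrightarrow> S i j = S' i j"
  shows "overlap d m R S = overlap d m R' S'"
  unfolding overlap_def by (intro sum.cong refl) (simp add: assms)

section \<open>Gram matrices and symmetries of the overlap\<close>

definition idm :: "nat \<Rightarrow> nat \<Rightarrow> complex" where
  "idm i j = (if i = j then 1 else 0)"

definition adj :: "(nat \<Rightarrow> nat \<Rightarrow> complex) \<Rightarrow> nat \<Rightarrow> nat \<Rightarrow> complex" where
  "adj R i j = cnj (R j i)"

text \<open>The product of \<open>G\<close> with its adjoint, used to exhibit positivity of the
  states of the ensemble.\<close>

definition gram :: "nat \<Rightarrow> (nat \<Rightarrow> nat \<Rightarrow> complex) \<Rightarrow> nat \<Rightarrow> nat \<Rightarrow> complex" where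
  "gram d G i j = (\<Sum>k<d. G i k * cnj (G j k))"

lemma gram_idm:
  assumes "i < d" "j < d"
  shows "gram d idm i j = idm i j"
proof -
  have "gram d idm i j = (\<Sum>k<d. if k = i then idm i j else 0)"
    unfolding gram_def by (intro sum.cong) (auto simp: idm_def)
  then show ?thesis using assms by simp
qed

context bipartite_effect
begin

text \<open>Columns of \<open>G\<close> and conjugated columns of \<open>H\<close> split the tensor
  product into rank-one terms, each of which gives a value of \<open>qform\<close>.\<close>

lemma overlap_gram_nonneg: "0 \<le> overlap d m (gram d G) (gram d H)"
proof -
  have "overlap d m (gram d G) (gram d H)
    = (\<Sum>k<d. \<Sum>l<d. overlap d m (\<lambda>i j. G i k * cnj (G j k)) (\<lambda>i j. H i l * cnj (H j l)))"
    unfolding gram_def by (simp only: overlap_sum_left overlap_sum_right finite_lessThan)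
  also have "\<dots> = (\<Sum>k<d. \<Sum>l<d. qform d m (\<lambda>t b. G t k * cnj (H b l)))"
    unfolding overlap_def qform_def by (intro sum.cong refl) (simp add: mult_ac)
  also have "0 \<le> \<dots>"
    by (intro sum_nonneg qform_nonneg)
  finally show ?thesis .
qed

text \<open>Hermiticity of \<open>M\<close> after exchanging row and column pairs; the chain of
  swaps only reorders the sums.\<close>

lemma overlap_adj: "overlap d m (adj R) (adj S) = cnj (overlap d m R S)"
proof -
  have "overlap d m (adj R) (adj S)
    = (\<Sum>s<d. \<Sum>a<d. \<Sum>t<d. \<Sum>b<d. cnj (m t b s a * R s t * cnj (S a b)))"
    unfolding overlap_def adj_def by (intro sum.cong refl) (auto simp: herm[symmetric])
  also have "\<dots> = (\<Sum>s<d. \<Sum>t<d. \<Sum>a<d. \<Sum>b<d. cnj (m t b s a * R s t * cnj (S a b)))"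
    by (rule sum.cong[OF refl], rule sum.swap)
  also have "\<dots> = (\<Sum>t<d. \<Sum>s<d. \<Sum>a<d. \<Sum>b<d. cnj (m t b s a * R s t * cnj (S a b)))"
    by (rule sum.swap)
  also have "\<dots> = (\<Sum>t<d. \<Sum>s<d. \<Sum>b<d. \<Sum>a<d. cnj (m t b s a * R s t * cnj (S a b)))"
    by (rule sum.cong[OF refl], rule sum.cong[OF refl], rule sum.swap)
  also have "\<dots> = (\<Sum>t<d. \<Sum>b<d. \<Sum>s<d. \<Sum>a<d. cnj (m t b s a * R s t * cnj (S a b)))"
    by (rule sum.cong[OF refl], rule sum.swap)
  also have "\<dots> = cnj (overlap d m R S)"
    by (simp add: overlap_def)
  finally show ?thesis .
qed

lemma overlap_idm_right: "overlap d m R idm = (\<Sum>s<d. \<Sum>t<d. (\<Sum>a<d. m s a t a) * R t s)"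
proof -
  have "overlap d m R idm = (\<Sum>s<d. \<Sum>a<d. \<Sum>t<d. \<Sum>b<d. if b = a then m s a t b * R t s else 0)"
    unfolding overlap_def by (intro sum.cong refl) (auto simp: idm_def)
  also have "\<dots> = (\<Sum>s<d. \<Sum>a<d. \<Sum>t<d. m s a t a * R t s)"
    by (intro sum.cong refl) simp
  also have "\<dots> = (\<Sum>s<d. \<Sum>t<d. \<Sum>a<d. m s a t a * R t s)"
    by (rule sum.cong[OF refl], rule sum.swap)
  finally show ?thesis by (simp add: sum_distrib_right)
qed

lemma overlap_idm_left: "overlap d m idm S = (\<Sum>b<d. \<Sum>a<d. (\<Sum>s<d. m s a s b) * cnj (S b a))"
proof -
  have "overlap d m idm S = (\<Sum>s<d. \<Sum>a<d. \<Sum>t<d. if t = s then (\<Sum>b<d. m s a t b * cnj (S b a)) else 0)"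
    unfolding overlap_def by (intro sum.cong refl) (auto simp: idm_def)
  also have "\<dots> = (\<Sum>s<d. \<Sum>a<d. \<Sum>b<d. m s a s b * cnj (S b a))"
    by (rule sum.cong[OF refl], rule sum.cong[OF refl]) simp
  also have "\<dots> = (\<Sum>s<d. \<Sum>b<d. \<Sum>a<d. m s a s b * cnj (S b a))"
    by (rule sum.cong[OF refl], rule sum.swap)
  also have "\<dots> = (\<Sum>b<d. \<Sum>s<d. \<Sum>a<d. m s a s b * cnj (S b a))"
    by (rule sum.swap)
  also have "\<dots> = (\<Sum>b<d. \<Sum>a<d. \<Sum>s<d. m s a s b * cnj (S b a))"
    by (rule sum.cong[OF refl], rule sum.swap)
  finally show ?thesis by (simp add: sum_distrib_right)
qed

lemma overlap_idm_idm: "overlap d m idm idm = of_real tr"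
proof -
  have "overlap d m idm idm = (\<Sum>s<d. \<Sum>t<d. if t = s then (\<Sum>a<d. m s a t a) else 0)"
    unfolding overlap_idm_right by (intro sum.cong refl) (auto simp: idm_def)
  also have "\<dots> = (\<Sum>s<d. \<Sum>a<d. m s a s a)" by simp
  also have "\<dots> = (\<Sum>s<d. \<Sum>a<d. of_real (Re (m s a s a)))"
  proof (intro sum.cong refl)
    fix s a assume "s \<in> {..<d}" "a \<in> {..<d}"
    then show "m s a s a = of_real (Re (m s a s a))"
      using herm[of s a s a] by (simp add: complex_eq_iff)
  qed
  finally show ?thesis by (simp add: tr_def)
qed

text \<open>Up to conjugation these are all the cross terms that arise when an alternative state is
  inserted into the Born rule.\<close>

lemma moments_overlap:
  "(\<Sum>q<d. \<Sum>p<d. (cmod (overlap d m (weyl d q p) idm))\<^sup>2) \<le> real d * tr\<^sup>2"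
  "(\<Sum>q<d. \<Sum>p<d. (cmod (overlap d m idm (adj (weyl d q p))))\<^sup>2) \<le> real d * tr\<^sup>2"
  "(\<Sum>q<d. \<Sum>p<d. (cmod (overlap d m (weyl d q p) (weyl d q p)))\<^sup>2) \<le> real d * tr\<^sup>2"
  "(\<Sum>q<d. \<Sum>p<d. (cmod (overlap d m (weyl d q p) (adj (weyl d q p))))\<^sup>2) \<le> real d * tr\<^sup>2"
  using moment_S moment_A moment_SA moment_SA'
  unfolding overlap_idm_right overlap_idm_left adj_def complex_cnj_cnj
  by (simp_all add: overlap_def)

end

section \<open>The ensemble of perturbed states\<close>

definition hobs :: "nat \<Rightarrow> nat \<Rightarrow> nat \<Rightarrow> complex \<Rightarrow> nat \<Rightarrow> nat \<Rightarrow> complex" where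
  "hobs d q p u i j = u * weyl d q p i j + cnj u * adj (weyl d q p) i j"

definition alt_fun :: "nat \<Rightarrow> nat \<Rightarrow> nat \<Rightarrow> complex \<Rightarrow> real \<Rightarrow> nat \<Rightarrow> nat \<Rightarrow> complex" where
  "alt_fun d q p u \<eta> i j = of_real (1 / real d) * idm i j + of_real (\<eta> / real d) * hobs d q p u i j"

definition alt_state :: "nat \<Rightarrow> nat \<Rightarrow> nat \<Rightarrow> complex \<Rightarrow> real \<Rightarrow> complex mat" where
  "alt_state d q p u \<eta> = mat d d (\<lambda>(i, j). alt_fun d q p u \<eta> i j)"

lemma adj_adj [simp]: "adj (adj R) = R"
  by (simp add: adj_def fun_eq_iff)

lemma adj_idm [simp]: "adj idm = idm"
  by (auto simp: adj_def idm_def fun_eq_iff)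

text \<open>\<open>(I + u W)\<close> times its adjoint; unitarity of \<open>W\<close> supplies the
  second copy of the identity.\<close>

lemma hobs_gram:
  assumes "i < d" "j < d" "cmod u = 1"
  shows "gram d (\<lambda>i k. idm i k + u * weyl d q p i k) i j = 2 * idm i j + hobs d q p u i j"
proof -
  have uu: "u * cnj u = 1" by (rule cnj_mult_norm_one) fact
  have "gram d (\<lambda>i k. idm i k + u * weyl d q p i k) i j
    = (\<Sum>k<d. idm i k * cnj (idm j k)) + cnj u * (\<Sum>k<d. idm i k * cnj (weyl d q p j k))
      + u * (\<Sum>k<d. weyl d q p i k * cnj (idm j k)) + (u * cnj u) * (\<Sum>k<d. weyl d q p i k * cnj (weyl d q p j k))"
    unfolding gram_def sum_distrib_left sum.distrib[symmetric]
    by (intro sum.cong refl) (simp add: algebra_simps)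
  also have "(\<Sum>k<d. idm i k * cnj (idm j k)) = idm i j"
    using gram_idm[OF assms(1,2)] by (simp add: gram_def)
  also have "(\<Sum>k<d. idm i k * cnj (weyl d q p j k)) = (\<Sum>k<d. if k = i then cnj (weyl d q p j k) else 0)"
    by (intro sum.cong refl) (auto simp: idm_def)
  also have "\<dots> = adj (weyl d q p) i j"
    using assms by (simp add: adj_def)
  also have "(\<Sum>k<d. weyl d q p i k * cnj (idm j k)) = (\<Sum>k<d. if k = j then weyl d q p i k else 0)"
    by (intro sum.cong refl) (auto simp: idm_def)
  also have "\<dots> = weyl d q p i j"
    using assms by simp
  also have "(\<Sum>k<d. weyl d q p i k * cnj (weyl d q p j k)) = idm i j"
    using assms by (simp add: weyl_unitary idm_def)
  finally show ?thesis by (simp add: uu hobs_def)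
qed

text \<open>For \<open>0 \<le> \<eta> \<le> 1 / 2\<close> both coefficients are nonnegative. The
  splitting yields positivity of the state and, later, a lower bound on its likelihood.\<close>

lemma alt_fun_gram:
  assumes "i < d" "j < d" "cmod u = 1"
  shows "alt_fun d q p u \<eta> i j = of_real ((1 - 2 * \<eta>) / real d) * gram d idm i j
    + of_real (\<eta> / real d) * gram d (\<lambda>i k. idm i k + u * weyl d q p i k) i j"
  using assms by (simp add: gram_idm hobs_gram alt_fun_def field_simps)

lemma gram_psd: "0 \<le> (\<Sum>i<d. \<Sum>j<d. gram d G i j * v j * cnj (v i))"
proof -
  have "(\<Sum>i<d. \<Sum>j<d. gram d G i j * v j * cnj (v i))
    = (\<Sum>i<d. \<Sum>j<d. \<Sum>k<d. (G i k * cnj (v i)) * (cnj (G j k) * v j))"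
    unfolding gram_def sum_distrib_right by (intro sum.cong refl) (simp add: mult_ac)
  also have "\<dots> = (\<Sum>i<d. \<Sum>k<d. \<Sum>j<d. (G i k * cnj (v i)) * (cnj (G j k) * v j))"
    by (rule sum.cong[OF refl], rule sum.swap)
  also have "\<dots> = (\<Sum>k<d. \<Sum>i<d. \<Sum>j<d. (G i k * cnj (v i)) * (cnj (G j k) * v j))"
    by (rule sum.swap)
  also have "\<dots> = (\<Sum>k<d. (\<Sum>i<d. G i k * cnj (v i)) * cnj (\<Sum>j<d. G j k * cnj (v j)))"
    by (simp add: sum_product)
  also have "0 \<le> \<dots>"
    by (intro sum_nonneg, simp only: complex_norm_square[symmetric], simp add: less_eq_complex_def)
  finally show ?thesis .
qed

lemma alt_fun_trace:
  assumes "q < d" "p < d" "(q, p) \<noteq> (0, 0)"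
  shows "(\<Sum>i<d. alt_fun d q p u \<eta> i i) = 1"
proof -
  have "(\<Sum>i<d. alt_fun d q p u \<eta> i i) = of_real (1 / real d) * (\<Sum>i<d. idm i i)
    + of_real (\<eta> / real d) * (u * (\<Sum>i<d. weyl d q p i i) + cnj u * cnj (\<Sum>i<d. weyl d q p i i))"
    by (simp add: alt_fun_def hobs_def adj_def sum.distrib sum_distrib_left distrib_left)
  also have "\<dots> = 1"
    using assms by (simp add: weyl_trace idm_def)
  finally show ?thesis .
qed

lemma alt_state_density:
  assumes "q < d" "p < d" "(q, p) \<noteq> (0, 0)" "cmod u = 1" "0 \<le> \<eta>" "\<eta> \<le> 1 / 2"
  shows "density_operator d (alt_state d q p u \<eta>)"
  unfolding density_operator_def psd_mat_def
proof (intro conjI ballI)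
  show "alt_state d q p u \<eta> \<in> carrier_mat d d" by (simp add: alt_state_def)
  show "mtrace (alt_state d q p u \<eta>) = 1"
    using alt_fun_trace[OF assms(1-3)] by (simp add: mtrace_def alt_state_def)
  fix v :: "complex vec" assume v: "v \<in> carrier_vec d"
  have "(alt_state d q p u \<eta> *\<^sub>v v) \<bullet>c v = (\<Sum>i<d. \<Sum>j<d. alt_fun d q p u \<eta> i j * v $ j * cnj (v $ i))"
    using v by (simp add: alt_state_def scalar_prod_def atLeast0LessThan sum_distrib_right)
  also have "\<dots> = of_real ((1 - 2 * \<eta>) / real d) * (\<Sum>i<d. \<Sum>j<d. gram d idm i j * v $ j * cnj (v $ i))
    + of_real (\<eta> / real d) * (\<Sum>i<d. \<Sum>j<d. gram d (\<lambda>i k. idm i k + u * weyl d q p i k) i j * v $ j * cnj (v $ i))"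
    unfolding sum_distrib_left sum.distrib[symmetric]
    by (intro sum.cong refl) (simp add: alt_fun_gram[OF _ _ assms(4)] algebra_simps)
  also have "0 \<le> \<dots>"
    using assms(5,6) by (intro add_nonneg_nonneg mult_nonneg_nonneg gram_psd) (auto simp: less_eq_complex_def)
  finally show "0 \<le> (alt_state d q p u \<eta> *\<^sub>v v) \<bullet>c v" .
qed

text \<open>The identity part drops out because \<open>W\<close> is traceless, and \<open>W\<close>
  against its adjoint has trace \<open>d\<close>. What remains is the trace of the square of
  \<open>W\<close>.\<close>

lemma amplitude_alt:
  assumes "q < d" "p < d" "(q, p) \<noteq> (0, 0)" "cmod u = 1"
  shows "amplitude d (alt_state d q p u \<eta>) q p = phase d q p * of_real \<eta> *
    (u * (\<Sum>i<d. \<Sum>j<d. weyl d q p i j * weyl d q p j i) / of_nat d + cnj u)"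
proof -
  define T where "T = (\<Sum>i<d. \<Sum>j<d. weyl d q p i j * weyl d q p j i)"
  have d: "0 < d" using assms by simp
  have "amplitude d (alt_state d q p u \<eta>) q p
    = (\<Sum>i<d. \<Sum>j<d. displacement d q p $$ (i, j) * alt_fun d q p u \<eta> j i)"
    using displacement_carrier[of d q p]
    by (simp add: amplitude_def mtrace_def scalar_prod_def atLeast0LessThan alt_state_def)
  also have "\<dots> = (\<Sum>i<d. \<Sum>j<d. phase d q p * of_real (1 / real d) * (weyl d q p i j * idm j i)
      + phase d q p * of_real (\<eta> / real d) * u * (weyl d q p i j * weyl d q p j i)
      + phase d q p * of_real (\<eta> / real d) * cnj u * (weyl d q p i j * cnj (weyl d q p i j)))"
    by (intro sum.cong refl) (simp add: displacement_index alt_fun_def hobs_def adj_def algebra_simps)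
  also have "\<dots> = phase d q p * of_real (1 / real d) * (\<Sum>i<d. \<Sum>j<d. weyl d q p i j * idm j i)
      + phase d q p * of_real (\<eta> / real d) * u * T
      + phase d q p * of_real (\<eta> / real d) * cnj u * (\<Sum>i<d. \<Sum>j<d. weyl d q p i j * cnj (weyl d q p i j))"
    by (simp add: T_def sum.distrib sum_distrib_left)
  also have "(\<Sum>i<d. \<Sum>j<d. weyl d q p i j * idm j i) = (\<Sum>i<d. \<Sum>j<d. if j = i then weyl d q p i j else 0)"
    by (intro sum.cong refl) (auto simp: idm_def)
  also have "\<dots> = 0"
    using assms by (simp add: weyl_trace)
  also have "(\<Sum>i<d. \<Sum>j<d. weyl d q p i j * cnj (weyl d q p i j)) = of_nat d"
    by (simp add: weyl_unitary)
  finally show ?thesis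
    using d unfolding T_def[symmetric] by (simp add: field_simps)
qed

text \<open>For \<open>2 q \<equiv> 2 p \<equiv> 0 (mod d)\<close> the square of the displacement has nonzero trace; the phase is
  chosen so that this trace cannot cancel the amplitude \<open>\<eta>\<close>.\<close>

definition good_phase :: "nat \<Rightarrow> nat \<Rightarrow> nat \<Rightarrow> complex" where
  "good_phase d q p = (if 0 \<le> Re (\<Sum>i<d. \<Sum>j<d. weyl d q p i j * weyl d q p j i) then 1 else \<i>)"

lemma norm_good_phase [simp]: "cmod (good_phase d q p) = 1"
  by (simp add: good_phase_def)

text \<open>Multiplying the bracket by the unimodular \<open>u\<close> gives
  \<open>u\<^sup>2 T / d + 1\<close>. The sign squares away and \<open>good_phase\<close> makes
  \<open>u\<^sup>2 T\<close> have nonnegative real part, so the modulus is at least 1.\<close>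

lemma amplitude_alt_ge:
  assumes "q < d" "p < d" "(q, p) \<noteq> (0, 0)" "0 \<le> \<eta>" "\<sigma> = 1 \<or> \<sigma> = (-1 :: real)"
  shows "\<eta> \<le> cmod (amplitude d (alt_state d q p (of_real \<sigma> * good_phase d q p) \<eta>) q p)"
proof -
  define T where "T = (\<Sum>i<d. \<Sum>j<d. weyl d q p i j * weyl d q p j i)"
  define u where "u = of_real \<sigma> * good_phase d q p"
  have u: "cmod u = 1" using assms(5) by (auto simp: u_def norm_mult)
  have "u * u = good_phase d q p * good_phase d q p"
    using assms(5) by (auto simp: u_def)
  then have "0 \<le> Re (u * u * T)"
    by (auto simp: good_phase_def T_def[symmetric])
  then have "1 \<le> Re (u * u * T / of_nat d + 1)"
    by simp
  also have "u * u * T / of_nat d + 1 = u * (u * T / of_nat d + cnj u)"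
    by (simp add: distrib_left mult.assoc cnj_mult_norm_one(1)[OF u])
  finally have "1 \<le> Re (u * (u * T / of_nat d + cnj u))" .
  also have "\<dots> \<le> cmod (u * (u * T / of_nat d + cnj u))" by (rule complex_Re_le_cmod)
  also have "\<dots> = cmod (u * T / of_nat d + cnj u)" using u by (simp add: norm_mult)
  finally have "\<eta> * 1 \<le> \<eta> * cmod (u * T / of_nat d + cnj u)"
    using assms(4) by (rule mult_left_mono)
  then show ?thesis
    using assms unfolding u_def[symmetric] amplitude_alt[OF assms(1-3) u] T_def[symmetric]
    by (simp add: norm_mult norm_phase)
qed

section \<open>One round: likelihood of an alternative as a quadratic polynomial in \<eta>\<close>

context bipartite_effect
begin

definition linear_part :: "nat \<Rightarrow> nat \<Rightarrow> complex \<Rightarrow> real" where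
  "linear_part q p u = 2 * Re (u * overlap d m (weyl d q p) idm) + 2 * Re (u * overlap d m idm (adj (weyl d q p)))"

definition quadratic_part :: "nat \<Rightarrow> nat \<Rightarrow> complex \<Rightarrow> real" where
  "quadratic_part q p u = 2 * Re (overlap d m (weyl d q p) (weyl d q p))
    + 2 * Re (u * u * overlap d m (weyl d q p) (adj (weyl d q p)))"

text \<open>By \<open>overlap_adj\<close> the cross terms come in conjugate pairs, so the expansion
  is real. In the quadratic part \<open>W\<close> against \<open>W\<close> is free of
  \<open>u\<close>, and \<open>W\<close> against its adjoint carries
  \<open>u\<^sup>2\<close>.\<close>

lemma overlap_alt:
  assumes "cmod u = 1"
  shows "overlap d m (alt_fun d q p u \<eta>) (alt_fun d q p u \<eta>)
    = of_real ((tr + \<eta> * linear_part q p u + \<eta>\<^sup>2 * quadratic_part q p u) / (real d)\<^sup>2)"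
proof -
  let ?W = "weyl d q p"
  define A B C E where "A = overlap d m ?W idm" and "B = overlap d m idm (adj ?W)"
    and "C = overlap d m ?W ?W" and "E = overlap d m ?W (adj ?W)"
  have uu: "u * cnj u = 1" by (rule cnj_mult_norm_one) fact
  have A': "overlap d m (adj ?W) idm = cnj A"
    using overlap_adj[of ?W idm] by (simp add: A_def)
  have B': "overlap d m idm ?W = cnj B"
    using overlap_adj[of idm "adj ?W"] by (simp add: B_def)
  have C': "overlap d m (adj ?W) (adj ?W) = cnj C"
    using overlap_adj[of ?W ?W] by (simp add: C_def)
  have E': "overlap d m (adj ?W) ?W = cnj E"
    using overlap_adj[of ?W "adj ?W"] by (simp add: E_def)
  have h: "hobs d q p u = (\<lambda>i j. u * ?W i j + cnj u * adj ?W i j)"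
    by (simp add: hobs_def fun_eq_iff)
  have a: "alt_fun d q p u \<eta> = (\<lambda>i j. of_real (1 / real d) * idm i j + of_real (\<eta> / real d) * hobs d q p u i j)"
    by (simp add: alt_fun_def fun_eq_iff)
  have two_Re: "z + cnj z = of_real (2 * Re z)" for z
    by (simp add: complex_eq_iff)
  have R: "overlap d m (hobs d q p u) idm = of_real (2 * Re (u * A))"
    unfolding h overlap_lin_left A' A_def[symmetric] two_Re[symmetric] by simp
  have L: "overlap d m idm (hobs d q p u) = of_real (2 * Re (u * B))"
    unfolding h overlap_lin_right B' B_def[symmetric] two_Re[symmetric] by simp
  have "overlap d m (hobs d q p u) (hobs d q p u)
    = (u * cnj u) * (C + cnj C) + (u * u * E + cnj (u * u * E))"
    unfolding h overlap_lin_right overlap_lin_left C' E' C_def[symmetric] E_def[symmetric]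
    by (simp add: algebra_simps)
  then have Q: "overlap d m (hobs d q p u) (hobs d q p u) = of_real (quadratic_part q p u)"
    unfolding uu two_Re by (simp add: quadratic_part_def C_def E_def)
  have "overlap d m (alt_fun d q p u \<eta>) (alt_fun d q p u \<eta>)
    = of_real (1 / real d * (1 / real d * tr + \<eta> / real d * (2 * Re (u * B)))
      + \<eta> / real d * (1 / real d * (2 * Re (u * A)) + \<eta> / real d * quadratic_part q p u))"
    unfolding a overlap_lin_left overlap_lin_right R L Q overlap_idm_idm by simp
  also have "1 / real d * (1 / real d * tr + \<eta> / real d * (2 * Re (u * B)))
      + \<eta> / real d * (1 / real d * (2 * Re (u * A)) + \<eta> / real d * quadratic_part q p u)
    = (tr + \<eta> * linear_part q p u + \<eta>\<^sup>2 * quadratic_part q p u) / (real d)\<^sup>2"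
    using d_pos by (simp add: linear_part_def A_def B_def field_simps power2_eq_square)
  finally show ?thesis .
qed

text \<open>In the Gram splitting every term is nonnegative, so the pure identity term with weight
  \<open>(1 - 2 \<eta>)\<^sup>2\<close> can be kept alone; at \<open>\<eta> = 3 / 8\<close> this
  weight is \<open>1 / 16\<close>.\<close>

lemma likelihood_lower:
  assumes "cmod u = 1" "0 \<le> \<eta>" "\<eta> \<le> 3 / 8"
  shows "tr / 16 \<le> tr + \<eta> * linear_part q p u + \<eta>\<^sup>2 * quadratic_part q p u"
proof -
  define K where "K = gram d (\<lambda>i k. idm i k + u * weyl d q p i k)"
  define a b where "a = (1 - 2 * \<eta>) / real d" and "b = \<eta> / real d"
  have ab: "0 \<le> a" "0 \<le> b" using assms by (auto simp: a_def b_def)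
  have "overlap d m (alt_fun d q p u \<eta>) (alt_fun d q p u \<eta>)
    = overlap d m (\<lambda>i j. of_real a * gram d idm i j + of_real b * K i j)
        (\<lambda>i j. of_real a * gram d idm i j + of_real b * K i j)"
    unfolding a_def b_def K_def by (rule overlap_cong; rule alt_fun_gram) (use assms in auto)
  also have "\<dots> = of_real (a\<^sup>2) * overlap d m (gram d idm) (gram d idm)
    + (of_real (a * b) * (overlap d m (gram d idm) K + overlap d m K (gram d idm))
      + of_real (b\<^sup>2) * overlap d m K K)"
    unfolding overlap_lin_left overlap_lin_right by (simp add: algebra_simps power2_eq_square)
  also have "overlap d m (gram d idm) (gram d idm) = of_real tr"
    unfolding overlap_idm_idm[symmetric] by (rule overlap_cong) (simp_all add: gram_idm)
  finally have eq: "Re (overlap d m (alt_fun d q p u \<eta>) (alt_fun d q p u \<eta>))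
    = a\<^sup>2 * tr + (a * b * (Re (overlap d m (gram d idm) K) + Re (overlap d m K (gram d idm)))
      + b\<^sup>2 * Re (overlap d m K K))"
    by (simp add: algebra_simps power2_eq_square)
  have nn: "0 \<le> Re (overlap d m (gram d idm) K)" "0 \<le> Re (overlap d m K (gram d idm))" "0 \<le> Re (overlap d m K K)"
    using overlap_gram_nonneg unfolding K_def by (auto simp: less_eq_complex_def)
  have "a\<^sup>2 * tr \<le> Re (overlap d m (alt_fun d q p u \<eta>) (alt_fun d q p u \<eta>))"
    unfolding eq using nn ab by (simp add: add_nonneg_nonneg)
  then have "a\<^sup>2 * tr \<le> (tr + \<eta> * linear_part q p u + \<eta>\<^sup>2 * quadratic_part q p u) / (real d)\<^sup>2"
    unfolding overlap_alt[OF assms(1)] Re_complex_of_real .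
  then have "(1 - 2 * \<eta>)\<^sup>2 * tr \<le> tr + \<eta> * linear_part q p u + \<eta>\<^sup>2 * quadratic_part q p u"
    using d_pos by (simp add: a_def power_divide divide_right_mono_neg field_simps)
  moreover have "(1 / 4)\<^sup>2 * tr \<le> (1 - 2 * \<eta>)\<^sup>2 * tr"
    using assms tr_nonneg by (intro mult_right_mono power_mono) auto
  ultimately show ?thesis by (simp add: power2_eq_square)
qed

lemma sq_two_Re_le:
  assumes "cmod z \<le> x" "cmod w \<le> y"
  shows "(2 * Re z + 2 * Re w)\<^sup>2 \<le> 8 * x\<^sup>2 + 8 * y\<^sup>2"
proof -
  have "\<bar>Re z\<bar> \<le> x" "\<bar>Re w\<bar> \<le> y"
    using assms abs_Re_le_cmod[of z] abs_Re_le_cmod[of w] by linarith+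
  then have "(Re z)\<^sup>2 \<le> x\<^sup>2" "(Re w)\<^sup>2 \<le> y\<^sup>2"
    by (simp_all add: abs_le_square_iff[symmetric])
  moreover have "(2 * Re z + 2 * Re w)\<^sup>2 \<le> 8 * (Re z)\<^sup>2 + 8 * (Re w)\<^sup>2"
    using zero_le_power2[of "Re z - Re w"] by (simp add: power2_eq_square algebra_simps)
  ultimately show ?thesis by linarith
qed

lemma parts_moment:
  assumes u: "\<And>q p. cmod (u q p) = 1"
  shows "(\<Sum>q<d. \<Sum>p<d. (linear_part q p (u q p))\<^sup>2) \<le> 16 * real d * tr\<^sup>2"
    and "(\<Sum>q<d. \<Sum>p<d. (quadratic_part q p (u q p))\<^sup>2) \<le> 16 * real d * tr\<^sup>2"
proof -
  note mo = moments_overlap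
  have "(\<Sum>q<d. \<Sum>p<d. (linear_part q p (u q p))\<^sup>2)
    \<le> (\<Sum>q<d. \<Sum>p<d. 8 * (cmod (overlap d m (weyl d q p) idm))\<^sup>2 + 8 * (cmod (overlap d m idm (adj (weyl d q p))))\<^sup>2)"
    unfolding linear_part_def by (intro sum_mono sq_two_Re_le) (simp_all add: norm_mult u)
  also have "\<dots> = 8 * (\<Sum>q<d. \<Sum>p<d. (cmod (overlap d m (weyl d q p) idm))\<^sup>2)
    + 8 * (\<Sum>q<d. \<Sum>p<d. (cmod (overlap d m idm (adj (weyl d q p))))\<^sup>2)"
    by (simp add: sum.distrib sum_distrib_left)
  also have "\<dots> \<le> 16 * real d * tr\<^sup>2" using mo(1,2) by linarith
  finally show "(\<Sum>q<d. \<Sum>p<d. (linear_part q p (u q p))\<^sup>2) \<le> 16 * real d * tr\<^sup>2" .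
  have "(\<Sum>q<d. \<Sum>p<d. (quadratic_part q p (u q p))\<^sup>2)
    \<le> (\<Sum>q<d. \<Sum>p<d. 8 * (cmod (overlap d m (weyl d q p) (weyl d q p)))\<^sup>2 + 8 * (cmod (overlap d m (weyl d q p) (adj (weyl d q p))))\<^sup>2)"
    unfolding quadratic_part_def by (intro sum_mono sq_two_Re_le) (simp_all add: norm_mult u)
  also have "\<dots> = 8 * (\<Sum>q<d. \<Sum>p<d. (cmod (overlap d m (weyl d q p) (weyl d q p)))\<^sup>2)
    + 8 * (\<Sum>q<d. \<Sum>p<d. (cmod (overlap d m (weyl d q p) (adj (weyl d q p))))\<^sup>2)"
    by (simp add: sum.distrib sum_distrib_left)
  also have "\<dots> \<le> 16 * real d * tr\<^sup>2" using mo(3,4) by linarith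
  finally show "(\<Sum>q<d. \<Sum>p<d. (quadratic_part q p (u q p))\<^sup>2) \<le> 16 * real d * tr\<^sup>2" .
qed

text \<open>Summing over \<sigma> cancels the linear part to first order and leaves
  \<open>\<eta>\<^sup>2 (2 y - 32 x\<^sup>2 - 32 \<eta>\<^sup>2 y\<^sup>2)\<close> per pair, which
  the second moments control.\<close>

lemma round_bound:
  fixes \<eta> :: real and u :: "nat \<Rightarrow> nat \<Rightarrow> complex"
  defines "z \<equiv> \<lambda>q p \<sigma>. (\<eta> * \<sigma> * linear_part q p (u q p) + \<eta>\<^sup>2 * quadratic_part q p (u q p)) / tr"
  assumes u: "\<And>q p. cmod (u q p) = 1" and \<eta>: "0 \<le> \<eta>" "\<eta> \<le> 3 / 8"
    and tr: "0 < tr" and I: "I \<subseteq> {..<d} \<times> {..<d}"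
  shows "- (1041 * \<eta>\<^sup>2 * (real d * sqrt (real d)))
    \<le> (\<Sum>(q, p)\<in>I. \<Sum>\<sigma>\<in>{1, -1}. z q p \<sigma> - 16 * (z q p \<sigma>)\<^sup>2)"
proof -
  define r where "r = sqrt (real d)"
  have r: "1 \<le> r" "r * r = real d" using d_pos by (simp_all add: r_def)
  define x y where "x q p = linear_part q p (u q p) / tr" and "y q p = quadratic_part q p (u q p) / tr" for q p
  define loss where "loss q p = \<eta>\<^sup>2 * ((r + 32) * (y q p)\<^sup>2 + 1 / r + 32 * (x q p)\<^sup>2)" for q p
  have loss_nonneg: "0 \<le> loss q p" for q p
    unfolding loss_def using r by (intro mult_nonneg_nonneg add_nonneg_nonneg) auto
  have \<eta>1: "\<eta>\<^sup>2 \<le> 1" using \<eta> by (simp add: power_le_one)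
  have pt: "- loss q p \<le> (\<Sum>\<sigma>\<in>{1, -1}. z q p \<sigma> - 16 * (z q p \<sigma>)\<^sup>2)" for q p
  proof -
    have z: "z q p \<sigma> = \<eta> * \<sigma> * x q p + \<eta>\<^sup>2 * y q p" for \<sigma>
      by (simp add: z_def x_def y_def add_divide_distrib)
    have "(\<Sum>\<sigma>\<in>{1, -1}. z q p \<sigma> - 16 * (z q p \<sigma>)\<^sup>2)
      = \<eta>\<^sup>2 * (2 * y q p - 32 * (x q p)\<^sup>2 - 32 * (\<eta>\<^sup>2 * (y q p)\<^sup>2))"
      unfolding z by (simp add: power2_eq_square algebra_simps)
    moreover have "- (r * (y q p)\<^sup>2 + 1 / r) \<le> 2 * y q p"
      \<comment> \<open>AM-GM, with weight \<open>sqrt d\<close> since \<open>y\<close> has size about \<open>1 / sqrt d\<close> on average\<close>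
    proof -
      have "0 \<le> (r * y q p + 1)\<^sup>2 / r" using r by simp
      also have "\<dots> = r * (y q p)\<^sup>2 + 2 * y q p + 1 / r"
        using r by (simp add: power2_eq_square field_simps)
      finally show ?thesis by simp
    qed
    moreover have "\<eta>\<^sup>2 * (y q p)\<^sup>2 \<le> 1 * (y q p)\<^sup>2"
      using \<eta>1 by (intro mult_right_mono) auto
    ultimately show ?thesis
      unfolding loss_def by (simp only: minus_mult_right) (intro mult_left_mono, auto simp: algebra_simps)
  qed
  have sx: "(\<Sum>q<d. \<Sum>p<d. (x q p)\<^sup>2) \<le> 16 * real d" and sy: "(\<Sum>q<d. \<Sum>p<d. (y q p)\<^sup>2) \<le> 16 * real d"
    using parts_moment[of u, OF u] tr
    by (simp_all add: x_def y_def power_divide sum_divide_distrib[symmetric] divide_le_eq)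
  \<comment> \<open>The moments are known over all pairs; since the loss is nonnegative, enlarging
    \<open>I\<close> is harmless.\<close>
  have "(\<Sum>(q, p)\<in>I. loss q p) \<le> (\<Sum>(q, p)\<in>{..<d} \<times> {..<d}. loss q p)"
    using I loss_nonneg by (intro sum_mono2) auto
  also have "\<dots> = (\<Sum>q<d. \<Sum>p<d. loss q p)"
    by (rule sum.cartesian_product[symmetric])
  also have "\<dots> = \<eta>\<^sup>2 * ((r + 32) * (\<Sum>q<d. \<Sum>p<d. (y q p)\<^sup>2) + (real d)\<^sup>2 * (1 / r) + 32 * (\<Sum>q<d. \<Sum>p<d. (x q p)\<^sup>2))"
    unfolding loss_def by (simp add: sum.distrib sum_distrib_left power2_eq_square distrib_left)
  \<comment> \<open>With \<open>d \<le> d r\<close> the contributions are \<open>16 + 512\<close>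
    from \<open>y\<close>, \<open>1\<close> from the AM-GM remainder and \<open>512\<close> from
    \<open>x\<close>, in total 1041.\<close>
  also have "\<dots> \<le> \<eta>\<^sup>2 * (1041 * (real d * r))"
  proof (intro mult_left_mono)
    have "(r + 32) * (\<Sum>q<d. \<Sum>p<d. (y q p)\<^sup>2) \<le> (r + 32) * (16 * real d)"
      using r sy by (intro mult_left_mono) auto
    also have "\<dots> = 16 * (real d * r) + 512 * real d"
      by (simp add: algebra_simps)
    finally have "(r + 32) * (\<Sum>q<d. \<Sum>p<d. (y q p)\<^sup>2) \<le> 16 * (real d * r) + 512 * real d" .
    moreover have "(real d)\<^sup>2 * (1 / r) = real d * r"
      using r by (simp add: power2_eq_square field_simps)
    moreover have "real d * 1 \<le> real d * r"
      using r by (intro mult_left_mono) auto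
    ultimately show "(r + 32) * (\<Sum>q<d. \<Sum>p<d. (y q p)\<^sup>2) + (real d)\<^sup>2 * (1 / r) + 32 * (\<Sum>q<d. \<Sum>p<d. (x q p)\<^sup>2)
      \<le> 1041 * (real d * r)"
      using sx by linarith
  qed simp
  finally have "(\<Sum>(q, p)\<in>I. loss q p) \<le> 1041 * \<eta>\<^sup>2 * (real d * r)" by simp
  moreover have "- (\<Sum>(q, p)\<in>I. loss q p) \<le> (\<Sum>(q, p)\<in>I. \<Sum>\<sigma>\<in>{1, -1}. z q p \<sigma> - 16 * (z q p \<sigma>)\<^sup>2)"
    unfolding sum_negf[symmetric] by (intro sum_mono) (auto simp: pt simp del: sum.insert)
  ultimately show ?thesis by (simp add: r_def)
qed

end

section \<open>Likelihood of adaptive records\<close>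

text \<open>Apply \<open>ln v \<le> v - 1\<close> to \<open>v = 1 / w\<close>: the error is
  \<open>z\<^sup>2 / w\<close>, at most \<open>16 z\<^sup>2\<close> since
  \<open>w \<ge> 1 / 16\<close>.\<close>

lemma ln_lower:
  fixes z :: real
  assumes "1 / 16 \<le> 1 + z"
  shows "z - 16 * z\<^sup>2 \<le> ln (1 + z)"
proof -
  define w where "w = 1 + z"
  have w: "1 / 16 \<le> w" using assms by (simp add: w_def)
  then have "- ln w \<le> 1 / w - 1"
    using ln_le_minus_one[of "1 / w"] by (simp add: ln_div)
  also have "1 / w - 1 = - z + z\<^sup>2 * (1 / w)"
    using w by (simp add: field_simps) (simp add: w_def power2_eq_square algebra_simps)
  also have "z\<^sup>2 * (1 / w) \<le> z\<^sup>2 * 16"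
    using w by (intro mult_left_mono) (simp_all add: field_simps)
  finally show ?thesis by (simp add: w_def)
qed

text \<open>Passing through \<open>exp\<close> and \<open>ln\<close> replaces the product over
  rounds by a sum, in which each round can be averaged over the ensemble separately.\<close>

lemma prod_one_plus_lower:
  fixes z :: "'a \<Rightarrow> real"
  assumes "finite K" "\<And>k. k \<in> K \<Longrightarrow> 1 / 16 \<le> 1 + z k"
  shows "1 + (\<Sum>k\<in>K. z k - 16 * (z k)\<^sup>2) \<le> (\<Prod>k\<in>K. 1 + z k)"
proof -
  have pos: "0 < 1 + z k" if "k \<in> K" for k
    using assms(2)[OF that] by linarith
  have "1 + (\<Sum>k\<in>K. z k - 16 * (z k)\<^sup>2) \<le> 1 + (\<Sum>k\<in>K. ln (1 + z k))"
    using assms(2) by (intro add_left_mono sum_mono ln_lower)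
  also have "\<dots> \<le> exp (\<Sum>k\<in>K. ln (1 + z k))"
    by (rule exp_ge_add_one_self)
  also have "\<dots> = (\<Prod>k\<in>K. 1 + z k)"
    using assms(1) pos by (simp add: exp_sum)
  finally show ?thesis .
qed

text \<open>Here \<open>t k\<close> is the factor of the mixed state and \<open>g k \<alpha>\<close>
  that of an alternative in round \<open>k\<close>. After linearising the product, the sums over
  rounds and ensemble commute, so a bound for each single round suffices.\<close>

lemma average_likelihood_lower:
  fixes t :: "nat \<Rightarrow> real" and g :: "nat \<Rightarrow> 'a \<Rightarrow> real"
  assumes "finite F"
    and t: "\<And>k. k < N \<Longrightarrow> 0 \<le> t k"
    and g: "\<And>k \<alpha>. k < N \<Longrightarrow> \<alpha> \<in> F \<Longrightarrow> t k / 16 \<le> g k \<alpha>"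
    and Q: "\<And>k. k < N \<Longrightarrow> 0 < t k \<Longrightarrow>
      - Q \<le> (\<Sum>\<alpha>\<in>F. (g k \<alpha> - t k) / t k - 16 * ((g k \<alpha> - t k) / t k)\<^sup>2)"
  shows "(\<Prod>k<N. t k) * (real (card F) - real N * Q) \<le> (\<Sum>\<alpha>\<in>F. \<Prod>k<N. g k \<alpha>)"
proof (cases "\<forall>k<N. 0 < t k")
  \<comment> \<open>A vanishing factor makes the left side zero; otherwise all ratios
    \<open>g k \<alpha> / t k\<close> make sense.\<close>
  case False
  then have "(\<Prod>k<N. t k) = 0" using t by (force intro: prod_zero)
  moreover have "0 \<le> (\<Sum>\<alpha>\<in>F. \<Prod>k<N. g k \<alpha>)"
    using t g by (intro sum_nonneg prod_nonneg) (force intro: order_trans[rotated])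
  ultimately show ?thesis by (simp only: mult_zero_left)
next
  case True
  define z where "z k \<alpha> = (g k \<alpha> - t k) / t k" for k \<alpha>
  have gz: "g k \<alpha> = t k * (1 + z k \<alpha>)" if "k < N" for k \<alpha>
  proof -
    have "t k \<noteq> 0" using True that by force
    then show ?thesis by (simp add: z_def field_simps)
  qed
  have z: "1 / 16 \<le> 1 + z k \<alpha>" if "k < N" "\<alpha> \<in> F" for k \<alpha>
  proof -
    have "t k * (1 / 16) \<le> t k * (1 + z k \<alpha>)"
      using g[OF that] gz[OF that(1)] by simp
    then show ?thesis using True that by (simp only: mult_le_cancel_left_pos)
  qed
  have "real (card F) - real N * Q = (\<Sum>\<alpha>\<in>F. 1) + (\<Sum>k<N. - Q)"
    by simp
  also have "\<dots> \<le> (\<Sum>\<alpha>\<in>F. 1) + (\<Sum>k<N. \<Sum>\<alpha>\<in>F. z k \<alpha> - 16 * (z k \<alpha>)\<^sup>2)"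
    using Q True unfolding z_def by (intro add_left_mono sum_mono) auto
  also have "\<dots> = (\<Sum>\<alpha>\<in>F. 1 + (\<Sum>k<N. z k \<alpha> - 16 * (z k \<alpha>)\<^sup>2))"
    unfolding sum.distrib by (simp only: sum.swap[of _ F])
  also have "\<dots> \<le> (\<Sum>\<alpha>\<in>F. \<Prod>k<N. 1 + z k \<alpha>)"
    using z by (intro sum_mono prod_one_plus_lower) auto
  finally have "(\<Prod>k<N. t k) * (real (card F) - real N * Q) \<le> (\<Prod>k<N. t k) * (\<Sum>\<alpha>\<in>F. \<Prod>k<N. 1 + z k \<alpha>)"
    using t by (intro mult_left_mono prod_nonneg) auto
  also have "\<dots> = (\<Sum>\<alpha>\<in>F. \<Prod>k<N. g k \<alpha>)"
    by (simp add: gz prod.distrib sum_distrib_left)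
  finally show ?thesis .
qed

section \<open>Outcome records and their total probability\<close>

lemma records_0: "records Out 0 = {[]}"
  by (auto simp: records_def)

lemma records_Suc:
  "records Out (Suc n) = (\<lambda>(h, x). h @ [x]) ` (SIGMA h:records Out n. Out h)"
proof (intro equalityI subsetI)
  fix h assume h: "h \<in> records Out (Suc n)"
  then have "length h = Suc n" by (simp add: records_def)
  then obtain h' x where h': "h = h' @ [x]" "length h' = n"
    by (metis length_Suc_conv_rev)
  have "h' \<in> records Out n"
    using h h' by (auto simp: records_def nth_append less_Suc_eq)
  moreover have "x \<in> Out h'"
    using h h' by (auto simp: records_def dest: spec[of _ n])
  ultimately show "h \<in> (\<lambda>(h, x). h @ [x]) ` (SIGMA h:records Out n. Out h)"
    using h' by auto
qed (auto simp: records_def nth_append less_Suc_eq)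

lemma records_prefix:
  assumes "h \<in> records Out N" "k < N"
  shows "take k h \<in> records Out k" "h ! k \<in> Out (take k h)"
  using assms by (auto simp: records_def min_def)

lemma record_prob_snoc:
  "record_prob M \<rho> (h @ [x]) = record_prob M \<rho> h * Re (mtrace (M h x * (\<rho> \<otimes>\<^sub>m conj_mat \<rho>)))"
  by (simp add: record_prob_def nth_append)

lemma finite_records:
  assumes "copywise_protocol d N Out M" "n \<le> N"
  shows "finite (records Out n)"
  using assms(2)
proof (induction n)
  case (Suc n)
  then have "finite (Out h)" if "h \<in> records Out n" for h
    using assms(1) that by (auto simp: copywise_protocol_def is_povm_def Suc_le_eq)
  with Suc show ?case
    unfolding records_Suc by (intro finite_imageI finite_SigmaI) auto
qed (simp add: records_0)

text \<open>Completeness leaves the trace of the state tensored with its conjugate, which is the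
  squared modulus of the trace.\<close>

lemma povm_total:
  assumes povm: "is_povm (d * d) Out M" and tr: "(\<Sum>i<d. R i i) = 1"
  shows "(\<Sum>x\<in>Out. Re (mtrace (M x * (mat d d (\<lambda>(i, j). R i j) \<otimes>\<^sub>m conj_mat (mat d d (\<lambda>(i, j). R i j)))))) = 1"
proof -
  define P where "P = mat d d (\<lambda>(i, j). R i j) \<otimes>\<^sub>m conj_mat (mat d d (\<lambda>(i, j). R i j))"
  have P: "P \<in> carrier_mat (d * d) (d * d)"
    by (simp add: P_def tensor_mat_def conj_mat_def)
  have "(\<Sum>x\<in>Out. mtrace (M x * P)) = (\<Sum>x\<in>Out. \<Sum>i<d * d. \<Sum>j<d * d. M x $$ (i, j) * P $$ (j, i))"
  proof (rule sum.cong[OF refl])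
    fix x assume "x \<in> Out"
    then have "M x \<in> carrier_mat (d * d) (d * d)"
      using povm by (simp add: is_povm_def psd_mat_def)
    then show "mtrace (M x * P) = (\<Sum>i<d * d. \<Sum>j<d * d. M x $$ (i, j) * P $$ (j, i))"
      using P by (simp add: mtrace_def scalar_prod_def atLeast0LessThan)
  qed
  also have "\<dots> = (\<Sum>i<d * d. \<Sum>x\<in>Out. \<Sum>j<d * d. M x $$ (i, j) * P $$ (j, i))"
    by (rule sum.swap)
  also have "\<dots> = (\<Sum>i<d * d. \<Sum>j<d * d. \<Sum>x\<in>Out. M x $$ (i, j) * P $$ (j, i))"
    by (rule sum.cong[OF refl], rule sum.swap)
  also have "\<dots> = (\<Sum>i<d * d. \<Sum>j<d * d. if j = i then P $$ (j, i) else 0)"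
    unfolding sum_distrib_right[symmetric]
    by (intro sum.cong refl) (use povm in \<open>auto simp: is_povm_def\<close>)
  also have "\<dots> = (\<Sum>i<d * d. P $$ (i, i))"
    by (rule sum.cong[OF refl]) simp
  also have "\<dots> = (\<Sum>s<d. \<Sum>a<d. R s s * cnj (R a a))"
    unfolding sum_lessThan_square
    by (intro sum.cong refl) (simp add: P_def tensor_mat_def conj_mat_def index_less)
  also have "\<dots> = (\<Sum>s<d. R s s) * cnj (\<Sum>a<d. R a a)"
    by (simp add: sum_product)
  finally have "(\<Sum>x\<in>Out. mtrace (M x * P)) = 1" by (simp add: tr)
  then have "Re (\<Sum>x\<in>Out. mtrace (M x * P)) = 1" by simp
  then show ?thesis unfolding P_def[symmetric] by simp
qed

lemma record_prob_total:
  assumes "copywise_protocol d N Out M" "n \<le> N" and tr: "(\<Sum>i<d. R i i) = 1"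
  shows "(\<Sum>h\<in>records Out n. record_prob M (mat d d (\<lambda>(i, j). R i j)) h) = 1"
  using assms(2)
proof (induction n)
  case 0
  then show ?case by (simp add: records_0 record_prob_def)
next
  case (Suc n)
  let ?\<rho> = "mat d d (\<lambda>(i, j). R i j)"
  have povm: "is_povm (d * d) (Out h) (M h)" if "h \<in> records Out n" for h
    using assms(1) that Suc.prems by (auto simp: copywise_protocol_def Suc_le_eq)
  have "(\<Sum>h\<in>records Out (Suc n). record_prob M ?\<rho> h)
    = (\<Sum>(h, x)\<in>(SIGMA h:records Out n. Out h). record_prob M ?\<rho> (h @ [x]))"
    unfolding records_Suc by (subst sum.reindex) (auto simp: inj_on_def case_prod_unfold)
  also have "\<dots> = (\<Sum>h\<in>records Out n. \<Sum>x\<in>Out h. record_prob M ?\<rho> (h @ [x]))"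
    using finite_records[OF assms(1), of n] Suc.prems povm
    by (subst sum.Sigma) (auto simp: is_povm_def)
  also have "\<dots> = (\<Sum>h\<in>records Out n. record_prob M ?\<rho> h)"
    by (rule sum.cong[OF refl])
      (simp add: record_prob_snoc sum_distrib_left[symmetric] povm_total[where R = R, OF povm tr])
  also have "\<dots> = 1" using Suc by simp
  finally show ?case .
qed

section \<open>The test between the mixed state and the ensemble\<close>

definition alternative :: "nat \<Rightarrow> real \<Rightarrow> (nat \<times> nat) \<times> real \<Rightarrow> complex mat" where
  "alternative d \<eta> \<alpha> = alt_state d (fst (fst \<alpha>)) (snd (fst \<alpha>))
     (of_real (snd \<alpha>) * good_phase d (fst (fst \<alpha>)) (snd (fst \<alpha>))) \<eta>"

text \<open>The pair \<open>(0, 0)\<close> is excluded because its operator is the identity and has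
  nonzero trace. The sign doubles the ensemble so that linear parts cancel.\<close>

definition alt_index :: "nat \<Rightarrow> ((nat \<times> nat) \<times> real) set" where
  "alt_index d = ({..<d} \<times> {..<d} - {(0, 0)}) \<times> {1, -1}"

text \<open>\<open>I / d\<close>, encoded as the member with \<open>\<eta> = 0\<close> so that the
  formulas for alternatives cover it.\<close>

definition mixed_state :: "nat \<Rightarrow> complex mat" where
  "mixed_state d = alt_state d 0 0 1 0"

lemma alt_state_zero: "alt_state d q p u 0 = mixed_state d"
proof -
  have "alt_fun d q p u 0 = alt_fun d 0 0 1 0"
    by (simp add: alt_fun_def fun_eq_iff)
  then show ?thesis by (simp add: mixed_state_def alt_state_def)
qed

lemma finite_alt_index: "finite (alt_index d)"
  by (simp add: alt_index_def)

lemma card_alt_index: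
  assumes "2 \<le> d"
  shows "3 / 2 * (real d)\<^sup>2 \<le> real (card (alt_index d))"
proof -
  have "card (alt_index d) = (d * d - 1) * 2"
    using assms by (simp add: alt_index_def card_cartesian_product card_Diff_singleton)
  moreover have "2 * 2 \<le> d * d" using assms by (intro mult_le_mono)
  then have "real (d * d - 1) = (real d)\<^sup>2 - 1" "4 \<le> (real d)\<^sup>2"
    by (simp_all add: of_nat_diff power2_eq_square flip: of_nat_mult)
  ultimately show ?thesis by simp
qed

lemma (in bipartite_effect) parts_sign:
  assumes "\<sigma> \<in> {1, -1 :: real}"
  shows "linear_part q p (of_real \<sigma> * u) = \<sigma> * linear_part q p u"
    "quadratic_part q p (of_real \<sigma> * u) = quadratic_part q p u"
  using assms by (auto simp: linear_part_def quadratic_part_def)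

text \<open>Once the record is fixed, so is the effect of each round, through its prefix. Adaptivity
  then disappears, and \<open>round_bound\<close> applies to every round.\<close>

lemma record_likelihood:
  assumes d: "2 \<le> d" and \<eta>: "0 \<le> \<eta>" "\<eta> \<le> 3 / 8"
    and prot: "copywise_protocol d N Out M" and red: "reduction_restricted_protocol d N Out M"
    and h: "h \<in> records Out N"
  shows "record_prob M (mixed_state d) h * (real (card (alt_index d))
      - real N * (1041 * \<eta>\<^sup>2 * (real d * sqrt (real d))))
    \<le> (\<Sum>\<alpha>\<in>alt_index d. record_prob M (alternative d \<eta> \<alpha>) h)"
    and "\<alpha> \<in> alt_index d \<Longrightarrow> 0 \<le> record_prob M (alternative d \<eta> \<alpha>) h"
    and "0 \<le> record_prob M (mixed_state d) h"
proof -
  define m where "m k = effect_coeff d (M (take k h) (h ! k))" for k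
  define t where "t k = bipartite_effect.tr d (m k)" for k
  define X where "X k qp = bipartite_effect.linear_part d (m k) (fst qp) (snd qp) (good_phase d (fst qp) (snd qp))" for k qp
  define Y where "Y k qp = bipartite_effect.quadratic_part d (m k) (fst qp) (snd qp) (good_phase d (fst qp) (snd qp))" for k qp
  define g where "g k \<alpha> = t k + \<eta> * (snd \<alpha> * X k (fst \<alpha>)) + \<eta>\<^sup>2 * Y k (fst \<alpha>)" for k and \<alpha> :: "(nat \<times> nat) \<times> real"
  have len: "length h = N" using h by (simp add: records_def)
  have psd: "psd_mat (d * d) (M (take k h) (h ! k))" if "k < N" for k
    using prot records_prefix[OF h that] that by (auto simp: copywise_protocol_def is_povm_def)
  have eff: "bipartite_effect d (m k)" if "k < N" for k
    unfolding m_def using d psd[OF that] red records_prefix[OF h that] that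
    by (intro bipartite_effect_coeff) (auto simp: reduction_restricted_protocol_def reduction_restricted_def)
  \<comment> \<open>Stated for arbitrary \<open>\<eta>'\<close> because \<open>\<eta>' = 0\<close>
    gives the mixed state; the common factor \<open>1 / d\<^sup>2\<close> per round appears on both
    sides of the comparison.\<close>
  have born: "Re (mtrace (M (take k h) (h ! k) * (alt_state d q p u \<eta>' \<otimes>\<^sub>m conj_mat (alt_state d q p u \<eta>'))))
    = (t k + \<eta>' * bipartite_effect.linear_part d (m k) q p u
        + \<eta>'\<^sup>2 * bipartite_effect.quadratic_part d (m k) q p u) / (real d)\<^sup>2"
    if "k < N" "cmod u = 1" for k q p u \<eta>'
    using psd[OF that(1)]
    unfolding alt_state_def t_def m_def
    by (subst born_overlap) (simp_all add: psd_mat_def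
        bipartite_effect.overlap_alt[OF eff[OF that(1), unfolded m_def] that(2)] del: of_real_divide)
  have unit: "cmod (of_real (snd \<alpha>) * good_phase d q p) = 1" if "\<alpha> \<in> alt_index d" for \<alpha> q p
    using that by (auto simp: alt_index_def norm_mult)
  have sign: "snd \<alpha> \<in> {1, -1}" if "\<alpha> \<in> alt_index d" for \<alpha>
    using that by (auto simp: alt_index_def)
  have gp: "g k \<alpha> = t k + \<eta> * bipartite_effect.linear_part d (m k) (fst (fst \<alpha>)) (snd (fst \<alpha>))
        (of_real (snd \<alpha>) * good_phase d (fst (fst \<alpha>)) (snd (fst \<alpha>)))
      + \<eta>\<^sup>2 * bipartite_effect.quadratic_part d (m k) (fst (fst \<alpha>)) (snd (fst \<alpha>))
        (of_real (snd \<alpha>) * good_phase d (fst (fst \<alpha>)) (snd (fst \<alpha>)))"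
    if "k < N" "\<alpha> \<in> alt_index d" for k \<alpha>
    using bipartite_effect.parts_sign[OF eff[OF that(1)] sign[OF that(2)]]
    by (simp add: g_def X_def Y_def)
  have rp_alt: "record_prob M (alternative d \<eta> \<alpha>) h = (\<Prod>k<N. g k \<alpha>) / ((real d)\<^sup>2) ^ N"
    if "\<alpha> \<in> alt_index d" for \<alpha>
    unfolding record_prob_def len alternative_def
    using unit[OF that] that by (simp add: born gp prod_dividef)
  have rp_mixed: "record_prob M (mixed_state d) h = (\<Prod>k<N. t k) / ((real d)\<^sup>2) ^ N"
    unfolding record_prob_def len mixed_state_def
    by (simp add: born prod_dividef)
  have t0: "0 \<le> t k" if "k < N" for k
    unfolding t_def by (rule bipartite_effect.tr_nonneg[OF eff[OF that]])
  have g16: "t k / 16 \<le> g k \<alpha>" if "k < N" "\<alpha> \<in> alt_index d" for k \<alpha>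
    unfolding gp[OF that] unfolding t_def
    by (rule bipartite_effect.likelihood_lower[OF eff[OF that(1)] unit[OF that(2)] \<eta>])
  show "0 \<le> record_prob M (mixed_state d) h"
    unfolding rp_mixed using t0 by (intro divide_nonneg_nonneg prod_nonneg) auto
  show "0 \<le> record_prob M (alternative d \<eta> \<alpha>) h" if "\<alpha> \<in> alt_index d"
    unfolding rp_alt[OF that]
  proof (intro divide_nonneg_nonneg prod_nonneg)
    show "0 \<le> g k \<alpha>" if "k \<in> {..<N}" for k
      using t0[of k] g16[of k \<alpha>] that \<open>\<alpha> \<in> alt_index d\<close> by simp
  qed simp
  have "(\<Prod>k<N. t k) * (real (card (alt_index d)) - real N * (1041 * \<eta>\<^sup>2 * (real d * sqrt (real d))))
    \<le> (\<Sum>\<alpha>\<in>alt_index d. \<Prod>k<N. g k \<alpha>)"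
  proof (rule average_likelihood_lower[OF finite_alt_index t0 g16])
    fix k assume k: "k < N" and tk: "0 < t k"
    have "(\<Sum>\<alpha>\<in>alt_index d. (g k \<alpha> - t k) / t k - 16 * ((g k \<alpha> - t k) / t k)\<^sup>2)
      = (\<Sum>qp\<in>{..<d} \<times> {..<d} - {(0, 0)}. \<Sum>\<sigma>\<in>{1, -1}. (\<eta> * \<sigma> * X k qp + \<eta>\<^sup>2 * Y k qp) / t k
          - 16 * ((\<eta> * \<sigma> * X k qp + \<eta>\<^sup>2 * Y k qp) / t k)\<^sup>2)"
      unfolding alt_index_def sum.cartesian_product
      by (intro sum.cong refl) (auto simp: g_def mult.assoc)
    then show "- (1041 * \<eta>\<^sup>2 * (real d * sqrt (real d)))
      \<le> (\<Sum>\<alpha>\<in>alt_index d. (g k \<alpha> - t k) / t k - 16 * ((g k \<alpha> - t k) / t k)\<^sup>2)"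
      using bipartite_effect.round_bound[OF eff[OF k] _ \<eta> tk[unfolded t_def],
          of "good_phase d" "{..<d} \<times> {..<d} - {(0, 0)}"]
      by (simp add: case_prod_unfold X_def Y_def t_def)
  qed
  then have "(\<Prod>k<N. t k) * (real (card (alt_index d)) - real N * (1041 * \<eta>\<^sup>2 * (real d * sqrt (real d))))
      / ((real d)\<^sup>2) ^ N
    \<le> (\<Sum>\<alpha>\<in>alt_index d. \<Prod>k<N. g k \<alpha>) / ((real d)\<^sup>2) ^ N"
    by (rule divide_right_mono) simp
  then show "record_prob M (mixed_state d) h * (real (card (alt_index d))
      - real N * (1041 * \<eta>\<^sup>2 * (real d * sqrt (real d))))
    \<le> (\<Sum>\<alpha>\<in>alt_index d. record_prob M (alternative d \<eta> \<alpha>) h)"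
    by (simp add: rp_alt rp_mixed sum_divide_distrib)
qed

text \<open>The mixed state has amplitude 0 at the chosen pair and the alternative at least
  \<open>9 / 4 \<epsilon>\<close>, more than the \<open>2 \<epsilon>\<close> that a common estimate
  could bridge.\<close>

lemma estimates_separate:
  assumes "0 < \<epsilon>" "\<alpha> \<in> alt_index d"
    and "estimates_within d \<epsilon> (mixed_state d) y"
  shows "\<not> estimates_within d \<epsilon> (alternative d (9 / 4 * \<epsilon>) \<alpha>) y"
proof
  assume within: "estimates_within d \<epsilon> (alternative d (9 / 4 * \<epsilon>) \<alpha>) y"
  obtain q p \<sigma> where \<alpha>: "\<alpha> = ((q, p), \<sigma>)" by (metis surj_pair)
  have qp: "q < d" "p < d" "(q, p) \<noteq> (0, 0)" "\<sigma> = 1 \<or> \<sigma> = -1"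
    using assms(2) by (auto simp: alt_index_def \<alpha>)
  let ?a = "amplitude d (alternative d (9 / 4 * \<epsilon>) \<alpha>) q p"
  have "amplitude d (mixed_state d) q p = 0"
    using amplitude_alt[OF qp(1-3), of 1 0] by (simp add: alt_state_zero)
  moreover have "cmod (y q p - amplitude d (mixed_state d) q p) \<le> \<epsilon>"
    using assms(3) qp(1,2) by (simp add: estimates_within_def)
  ultimately have "cmod (y q p) \<le> \<epsilon>" by simp
  moreover have "cmod (y q p - ?a) \<le> \<epsilon>"
    using within qp(1,2) by (simp add: estimates_within_def)
  moreover have "9 / 4 * \<epsilon> \<le> cmod ?a"
    using amplitude_alt_ge[OF qp(1-3), of "9 / 4 * \<epsilon>" \<sigma>] qp(4) assms(1)
    by (simp add: alternative_def \<alpha>)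
  moreover have "cmod ?a \<le> cmod (y q p) + cmod (y q p - ?a)"
    by (metis norm_triangle_sub norm_minus_commute)
  ultimately show False using assms(1) by linarith
qed

lemma copies_lower_bound:
  assumes d: "2 \<le> d" and \<epsilon>: "0 < \<epsilon>" "\<epsilon> < 1 / 6"
    and prot: "copywise_protocol d N Out M" and red: "reduction_restricted_protocol d N Out M"
    and learns: "learns_amplitudes d N Out M est \<epsilon>"
  shows "1 / 10000 * (1 / \<epsilon>\<^sup>2) * sqrt (real d) \<le> real N"
proof -
  \<comment> \<open>The factor must exceed 2 to separate the states; \<open>9 / 4\<close> also turns
    \<open>\<epsilon> < 1 / 6\<close> into \<open>\<eta> < 3 / 8\<close>, as the likelihood bound
    demands.\<close>
  define \<eta> where "\<eta> = 9 / 4 * \<epsilon>"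
  have \<eta>: "0 \<le> \<eta>" "\<eta> \<le> 3 / 8" using \<epsilon> by (auto simp: \<eta>_def)
  define H where "H = records Out N"
  define G where "G \<rho> = {h \<in> H. estimates_within d \<epsilon> \<rho> (est h)}" for \<rho>
  define L where "L = real (card (alt_index d)) - real N * (1041 * \<eta>\<^sup>2 * (real d * sqrt (real d)))"
  have fin: "finite H" unfolding H_def by (rule finite_records[OF prot order_refl])
  have success: "2 / 3 \<le> (\<Sum>h\<in>G \<rho>. record_prob M \<rho> h)" if "density_operator d \<rho>" for \<rho>
    using learns that by (simp add: learns_amplitudes_def success_prob_def G_def H_def)
  \<comment> \<open>The mixed state is viewed as the \<open>\<eta> = 0\<close> member at the
    nontrivial pair \<open>(1, 0)\<close>, which exists since \<open>d \<ge> 2\<close>.\<close>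
  have mixed_success: "2 / 3 \<le> (\<Sum>h\<in>G (mixed_state d). record_prob M (mixed_state d) h)"
    using success alt_state_density[of 1 d 0 1 0] d by (simp add: alt_state_zero)
  \<comment> \<open>Records good for the mixed state and for the alternative are disjoint, and the
    latter have probability at least \<open>2 / 3\<close>.\<close>
  have fail: "(\<Sum>h\<in>G (mixed_state d). record_prob M (alternative d \<eta> \<alpha>) h) \<le> 1 / 3"
    if \<alpha>: "\<alpha> \<in> alt_index d" for \<alpha>
  proof -
    let ?P = "record_prob M (alternative d \<eta> \<alpha>)"
    obtain q p \<sigma> where \<alpha>_eq: "\<alpha> = ((q, p), \<sigma>)" by (metis surj_pair)
    then have qp: "q < d" "p < d" "(q, p) \<noteq> (0, 0)" "\<sigma> = 1 \<or> \<sigma> = -1"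
      using \<alpha> by (auto simp: alt_index_def)
    have "density_operator d (alternative d \<eta> \<alpha>)"
      unfolding alternative_def \<alpha>_eq using qp \<eta> by (intro alt_state_density) (auto simp: norm_mult)
    note suc = success[OF this]
    have "(\<Sum>h\<in>H. ?P h) = 1"
      unfolding H_def alternative_def alt_state_def \<alpha>_eq
      using record_prob_total[OF prot order_refl] alt_fun_trace qp by auto
    moreover have "(\<Sum>h\<in>G (mixed_state d). ?P h) + (\<Sum>h\<in>G (alternative d \<eta> \<alpha>). ?P h)
      = (\<Sum>h\<in>G (mixed_state d) \<union> G (alternative d \<eta> \<alpha>). ?P h)"
      using fin estimates_separate[OF \<epsilon>(1) \<alpha>]
      by (intro sum.union_disjoint[symmetric]) (auto simp: G_def \<eta>_def)
    moreover have "\<dots> \<le> (\<Sum>h\<in>H. ?P h)"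
      using fin record_likelihood(2)[OF d \<eta> prot red _ \<alpha>]
      by (intro sum_mono2) (auto simp: G_def H_def)
    ultimately show ?thesis using suc by linarith
  qed
  have "(\<Sum>h\<in>G (mixed_state d). record_prob M (mixed_state d) h) * L
    \<le> (\<Sum>h\<in>G (mixed_state d). \<Sum>\<alpha>\<in>alt_index d. record_prob M (alternative d \<eta> \<alpha>) h)"
    unfolding sum_distrib_right L_def
    using record_likelihood(1)[OF d \<eta> prot red] by (intro sum_mono) (auto simp: G_def H_def)
  also have "\<dots> = (\<Sum>\<alpha>\<in>alt_index d. \<Sum>h\<in>G (mixed_state d). record_prob M (alternative d \<eta> \<alpha>) h)"
    by (rule sum.swap)
  also have "\<dots> \<le> (\<Sum>\<alpha>\<in>alt_index d. 1 / 3)"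
    by (intro sum_mono fail)
  finally have main: "(\<Sum>h\<in>G (mixed_state d). record_prob M (mixed_state d) h) * L \<le> real (card (alt_index d)) / 3"
    by simp
  \<comment> \<open>For \<open>L \<ge> 0\<close> the success probability \<open>2 / 3\<close> gives
    \<open>2 / 3 L \<le> card / 3\<close>; a negative \<open>L\<close> satisfies the bound
    trivially.\<close>
  have half: "L \<le> real (card (alt_index d)) / 2"
  proof (cases "0 \<le> L")
    case True
    then have "2 / 3 * L \<le> (\<Sum>h\<in>G (mixed_state d). record_prob M (mixed_state d) h) * L"
      by (intro mult_right_mono mixed_success)
    then show ?thesis using main by linarith
  qed simp
  define r where "r = sqrt (real d)"
  have r: "0 < r" "r * r = real d" using d by (simp_all add: r_def)
  \<comment> \<open>Half of the ensemble size, at least \<open>3 / 4 d\<^sup>2\<close>, must be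
    absorbed by the accumulated loss.\<close>
  have "3 / 4 * (real d)\<^sup>2 \<le> real N * (1041 * \<eta>\<^sup>2 * (real d * r))"
    using half card_alt_index[OF d] unfolding L_def r_def by linarith
  moreover have "(real d * r) * (3 / 4 * r) = 3 / 4 * (real d)\<^sup>2"
    by (simp add: power2_eq_square flip: r(2))
  moreover have "real N * (1041 * \<eta>\<^sup>2 * (real d * r)) = (real d * r) * (real N * (1041 * (81 / 16) * \<epsilon>\<^sup>2))"
    by (simp add: \<eta>_def power2_eq_square)
  ultimately have "(real d * r) * (3 / 4 * r) \<le> (real d * r) * (real N * (1041 * (81 / 16) * \<epsilon>\<^sup>2))"
    by simp
  then have "3 / 4 * r \<le> real N * (1041 * (81 / 16) * \<epsilon>\<^sup>2)"
    using d r(1) by (simp only: mult_le_cancel_left_pos mult_pos_pos of_nat_0_less_iff)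
  \<comment> \<open>\<open>1041 * 81 / 16\<close> is about 5270; rounding up to 7500 makes division
    by \<open>3 / 4\<close> give 10000.\<close>
  also have "\<dots> \<le> 7500 * (real N * \<epsilon>\<^sup>2)"
    by simp
  finally have "r \<le> 10000 * (real N * \<epsilon>\<^sup>2)" by simp
  then show ?thesis
    using \<epsilon>(1) by (simp add: r_def field_simps)
qed

theorem theorem3:
  shows "\<exists>c::real. 0 < c \<and>
    (\<forall>(d::nat) (\<epsilon>::real) (N::nat)
       (Out :: nat list \<Rightarrow> nat set)
       (M :: nat list \<Rightarrow> nat \<Rightarrow> complex mat)
       (est :: nat list \<Rightarrow> nat \<Rightarrow> nat \<Rightarrow> complex).
       2 \<le> d \<longrightarrow> 0 < \<epsilon> \<longrightarrow> \<epsilon> < 1 / 6 \<longrightarrow>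
       copywise_protocol d N Out M \<longrightarrow>
       reduction_restricted_protocol d N Out M \<longrightarrow>
       learns_amplitudes d N Out M est \<epsilon> \<longrightarrow>
       c * (1 / \<epsilon>\<^sup>2) * sqrt (real d) \<le> real N)"
  by (rule exI[of _ "1 / 10000"]) (use copies_lower_bound in auto)

end
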